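(* Let $\Omega\subseteq\mathbb R^N$ be open, let $\phi\in L^\infty(\Omega)+L^{p_\phi}(\Omega)$ (complex-valued), and let $(a,b)\in\mathbb C^2$ be such that $a\ne0$, $\mathrm{Re}(a)\ge0$ and $\mathrm{Re}(a\overline b)+\mathrm{Re}(a\overline\phi)\ge0$ a.e. in $\Omega$. If $\mathrm{Re}(a\overline b)+\mathrm{Re}(a\overline\phi)=0$ on a set of positive measure, then assume further that one of the three following conditions is satisfied: 1. $\mathrm{Re}(b)+\mathrm{Re}(\phi)>0$ a.e. in $\Omega$; 2. $\mathrm{Im}(b)+\mathrm{Im}(\phi)>0$ a.e. in $\Omega$; 3. $\mathrm{Im}(b)+\mathrm{Im}(\phi)<0$ a.e. in $\Omega$. If $F\in H^{-1}(\Omega)+L^\infty(\Omega)$ (respectively, $\Omega$ has finite measure and Lipschitz continuous boundary and $F\in H^1(\Omega)^\star$) and if $(u_1,U_1)$ and $(u_2,U_2)$ are two global weak solutions to $$-\Delta u+a\,U+b\,u+\phi\,u=F$$ with the homogeneous Dirichlet (respectively, Neumann) boundary condition, then $u_1=u_2$ and $U_1=U_2$.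
   Context: All functions are complex-valued unless specified and all spaces are real vector spaces; $X^\star$ is the real topological dual of $X$; $H^{-1}(\Omega)=H^1_0(\Omega)^\star$; $\langle f,g\rangle_{L^{p'},L^p}=\mathrm{Re}\int_\Omega f\,\overline g\,dx$; $(H^1_0(\Omega)\cap L^1(\Omega))^\star=H^{-1}(\Omega)+L^\infty(\Omega)$. $p_\phi=2$ if $N=1$, $p_\phi=2+\kappa$ for some $\kappa>0$ if $N=2$, $p_\phi=N$ if $N\ge3$. Saturated section associated to $u\in L^1_{\rm loc}(\Omega)$: $U\in L^\infty(\Omega)$ with $\|U\|_{L^\infty}\le1$ and $U=u/|u|$ a.e. where $u\neq0$. Global weak solution: $U$ is a saturated section associated to $u$ and $$\langle\nabla u,\nabla v\rangle_{L^2,L^2}+\langle aU,v\rangle_{L^\infty,L^1}+\langle bu,v\rangle_{L^2,L^2}+\langle\phi u,v\rangle_{L^2,L^2}=\langle F,v\rangle_{X^\star,X}\quad\forall v\in X,$$ where, for the Dirichlet condition, $u\in X=H^1_0(\Omega)\cap L^1(\Omega)$, and, for the Neumann condition ($\Omega$ of finite measure with Lipschitz continuous boundary, in the usual uniform sense for which the Sobolev embeddings of $H^1(\Omega)$ hold), $u\in X=H^1(\Omega)$. *)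

theory Defs
  imports "HOL-Analysis.Analysis"
begin

text \<open>
  \<open>\<real>\<^sup>N\<close> is an arbitrary type of class \<open>euclidean_space\<close>, with \<open>N = DIM('a)\<close>.
  Elements of function spaces over \<open>\<Omega>\<close> are represented by functions on the whole type of which
  only the restriction to \<open>\<Omega>\<close> matters; equality in these spaces is equality almost everywhere
  in \<open>\<Omega>\<close> for the Lebesgue measure.
\<close>

subsection \<open>Lebesgue spaces and the bracket\<close>

definition Lp :: "'a::euclidean_space set \<Rightarrow> real \<Rightarrow> ('a \<Rightarrow> complex) set" where
  "Lp \<Omega> p = {f. f \<in> borel_measurable (lebesgue_on \<Omega>) \<and>
                 integrable (lebesgue_on \<Omega>) (\<lambda>x. norm (f x) powr p)}"

definition Linf :: "'a::euclidean_space set \<Rightarrow> ('a \<Rightarrow> complex) set" where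
  "Linf \<Omega> = {f. f \<in> borel_measurable (lebesgue_on \<Omega>) \<and>
                 (\<exists>C. AE x in lebesgue_on \<Omega>. norm (f x) \<le> C)}"

definition L1_loc :: "'a::euclidean_space set \<Rightarrow> ('a \<Rightarrow> complex) set" where
  "L1_loc \<Omega> = {f. f \<in> borel_measurable (lebesgue_on \<Omega>) \<and>
                   (\<forall>K. compact K \<longrightarrow> K \<subseteq> \<Omega> \<longrightarrow> integrable (lebesgue_on K) f)}"

definition Linf_plus_Lp :: "'a::euclidean_space set \<Rightarrow> real \<Rightarrow> ('a \<Rightarrow> complex) set" where
  "Linf_plus_Lp \<Omega> p =
     {f. \<exists>g\<in>Linf \<Omega>. \<exists>h\<in>Lp \<Omega> p. AE x in lebesgue_on \<Omega>. f x = g x + h x}"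

definition bracket :: "'a::euclidean_space set \<Rightarrow> ('a \<Rightarrow> complex) \<Rightarrow> ('a \<Rightarrow> complex) \<Rightarrow> real" where
  "bracket \<Omega> f g = Re (LINT x|lebesgue_on \<Omega>. f x * cnj (g x))"

text \<open>The admissible values of the exponent \<open>p\<^sub>\<phi>\<close>; in dimension 2 any \<open>2 + \<kappa>\<close> with \<open>\<kappa> > 0\<close>.\<close>

definition potential_exponent :: "nat \<Rightarrow> real \<Rightarrow> bool" where
  "potential_exponent N p \<longleftrightarrow>
     (if N = 1 then p = 2 else if N = 2 then \<exists>\<kappa>>0. p = 2 + \<kappa> else p = real N)"

subsection \<open>Test functions and Sobolev spaces\<close>

text \<open>\<open>C_diff k f\<close>: the function \<open>f\<close> is of class \<open>C\<^sup>k\<close> on the whole space.\<close>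

primrec C_diff :: "nat \<Rightarrow> ('a::euclidean_space \<Rightarrow> complex) \<Rightarrow> bool" where
  "C_diff 0 f \<longleftrightarrow> continuous_on UNIV f"
| "C_diff (Suc k) f \<longleftrightarrow> (\<forall>x. f differentiable (at x)) \<and>
     (\<forall>i\<in>Basis. C_diff k (\<lambda>x. frechet_derivative f (at x) i))"

definition test_functions :: "'a::euclidean_space set \<Rightarrow> ('a \<Rightarrow> complex) set" where
  "test_functions \<Omega> = {\<psi>. (\<forall>k. C_diff k \<psi>) \<and>
     compact (closure {x. \<psi> x \<noteq> 0}) \<and> closure {x. \<psi> x \<noteq> 0} \<subseteq> \<Omega>}"

definition has_weak_partial ::
    "'a::euclidean_space set \<Rightarrow> 'a \<Rightarrow> ('a \<Rightarrow> complex) \<Rightarrow> ('a \<Rightarrow> complex) \<Rightarrow> bool" where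
  "has_weak_partial \<Omega> i u g \<longleftrightarrow> u \<in> L1_loc \<Omega> \<and> g \<in> L1_loc \<Omega> \<and>
     (\<forall>\<psi>\<in>test_functions \<Omega>.
        (LINT x|lebesgue_on \<Omega>. u x * frechet_derivative \<psi> (at x) i)
          = - (LINT x|lebesgue_on \<Omega>. g x * \<psi> x))"

text \<open>A representative of the weak derivative, which is unique up to null sets.\<close>

definition weak_partial ::
    "'a::euclidean_space set \<Rightarrow> 'a \<Rightarrow> ('a \<Rightarrow> complex) \<Rightarrow> 'a \<Rightarrow> complex" where
  "weak_partial \<Omega> i u = (SOME g. has_weak_partial \<Omega> i u g)"

definition grad_bracket ::
    "'a::euclidean_space set \<Rightarrow> ('a \<Rightarrow> complex) \<Rightarrow> ('a \<Rightarrow> complex) \<Rightarrow> real" where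
  "grad_bracket \<Omega> u v = (\<Sum>i\<in>Basis. bracket \<Omega> (weak_partial \<Omega> i u) (weak_partial \<Omega> i v))"

definition H1 :: "'a::euclidean_space set \<Rightarrow> ('a \<Rightarrow> complex) set" where
  "H1 \<Omega> = {u \<in> Lp \<Omega> 2. \<forall>i\<in>Basis. \<exists>g\<in>Lp \<Omega> 2. has_weak_partial \<Omega> i u g}"

definition H1_norm :: "'a::euclidean_space set \<Rightarrow> ('a \<Rightarrow> complex) \<Rightarrow> real" where
  "H1_norm \<Omega> u = sqrt (bracket \<Omega> u u + grad_bracket \<Omega> u u)"

definition H10 :: "'a::euclidean_space set \<Rightarrow> ('a \<Rightarrow> complex) set" where
  "H10 \<Omega> = {u \<in> H1 \<Omega>. \<exists>\<psi>. (\<forall>n. \<psi> n \<in> test_functions \<Omega>) \<and>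
     (\<lambda>n. H1_norm \<Omega> (\<lambda>x. u x - \<psi> n x)) \<longlonglongrightarrow> 0}"

subsection \<open>Real topological duals\<close>

text \<open>
  The spaces are complex-valued but the functionals are real-valued and only real-linear.
  Boundedness makes a functional compatible with equality almost everywhere.
\<close>

definition real_dual ::
    "('a \<Rightarrow> complex) set \<Rightarrow> (('a \<Rightarrow> complex) \<Rightarrow> real) \<Rightarrow> (('a \<Rightarrow> complex) \<Rightarrow> real) set" where
  "real_dual V nrm = {F.
     (\<forall>v\<in>V. \<forall>w\<in>V. F (\<lambda>x. v x + w x) = F v + F w) \<and>
     (\<forall>r. \<forall>v\<in>V. F (\<lambda>x. r *\<^sub>R v x) = r * F v) \<and>
     (\<exists>C. \<forall>v\<in>V. \<bar>F v\<bar> \<le> C * nrm v)}"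

text \<open>\<open>H\<^sup>-\<^sup>1(\<Omega>) + L\<^sup>\<infinity>(\<Omega>)\<close>, acting on \<open>H\<^sup>1\<^sub>0(\<Omega>) \<inter> L\<^sup>1(\<Omega>)\<close>.\<close>

definition H_minus1_plus_Linf ::
    "'a::euclidean_space set \<Rightarrow> (('a \<Rightarrow> complex) \<Rightarrow> real) set" where
  "H_minus1_plus_Linf \<Omega> = {F. \<exists>G\<in>real_dual (H10 \<Omega>) (H1_norm \<Omega>). \<exists>f\<in>Linf \<Omega>.
     \<forall>v\<in>H10 \<Omega> \<inter> Lp \<Omega> 1. F v = G v + bracket \<Omega> f v}"

subsection \<open>Lipschitz boundary\<close>

text \<open>
  Uniformly Lipschitz boundary (Stein's minimally smooth domains, with Lipschitz graphs): this is
  the usual version for possibly unbounded sets, and for bounded sets it amounts to \<open>\<Omega>\<close> being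
  locally the strict epigraph of a Lipschitz function. In the direction \<open>e\<close>, the coordinates of
  \<open>x\<close> are \<open>y' = x - (x \<bullet> e) *\<^sub>R e\<close> in the hyperplane orthogonal to \<open>e\<close>, and \<open>y\<^sub>N = x \<bullet> e\<close>.
\<close>

definition uniformly_Lipschitz_boundary :: "'a::euclidean_space set \<Rightarrow> bool" where
  "uniformly_Lipschitz_boundary \<Omega> \<longleftrightarrow>
     (\<exists>\<epsilon>>0. \<exists>L. \<exists>M::nat. \<exists>V::nat \<Rightarrow> 'a set.
        (\<forall>n. open (V n)) \<and>
        (\<forall>x\<in>frontier \<Omega>. \<exists>n. ball x \<epsilon> \<subseteq> V n) \<and>
        (\<forall>x. finite {n. x \<in> V n} \<and> card {n. x \<in> V n} \<le> M) \<and>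
        (\<forall>n. \<exists>e g. norm e = 1 \<and> L-lipschitz_on {y. y \<bullet> e = 0} g \<and>
               V n \<inter> \<Omega> = V n \<inter> {x. g (x - (x \<bullet> e) *\<^sub>R e) < x \<bullet> e}))"

subsection \<open>Global weak solutions\<close>

definition saturated_section ::
    "'a::euclidean_space set \<Rightarrow> ('a \<Rightarrow> complex) \<Rightarrow> ('a \<Rightarrow> complex) \<Rightarrow> bool" where
  "saturated_section \<Omega> u U \<longleftrightarrow> u \<in> L1_loc \<Omega> \<and> U \<in> Linf \<Omega> \<and>
     (AE x in lebesgue_on \<Omega>. norm (U x) \<le> 1) \<and>
     (AE x in lebesgue_on \<Omega>. u x \<noteq> 0 \<longrightarrow> U x = u x / complex_of_real (norm (u x)))"

text \<open>
  The bracket \<open>\<langle>\<phi>u, v\<rangle>\<close> of \<open>L\<^sup>2, L\<^sup>2\<close> presupposes \<open>\<phi>u \<in> L\<^sup>2(\<Omega>)\<close>. It is stated explicitly, because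
  \<open>bracket\<close> is total (the integral of a non-integrable function is 0). For \<open>\<phi>\<close> in
  \<open>L\<^sup>\<infinity>(\<Omega>) + L\<^sup>p(\<Omega>)\<close>, with \<open>p\<close> an admissible exponent, and for \<open>u\<close> in \<open>H\<^sup>1\<^sub>0(\<Omega>)\<close>, or in \<open>H\<^sup>1(\<Omega>)\<close>
  with \<open>\<Omega>\<close> uniformly Lipschitz, it holds by the Sobolev embeddings and the Hoelder inequality.
\<close>

definition weak_solution_in ::
    "('a \<Rightarrow> complex) set \<Rightarrow> 'a::euclidean_space set \<Rightarrow> complex \<Rightarrow> complex \<Rightarrow> ('a \<Rightarrow> complex) \<Rightarrow>
     (('a \<Rightarrow> complex) \<Rightarrow> real) \<Rightarrow> ('a \<Rightarrow> complex) \<Rightarrow> ('a \<Rightarrow> complex) \<Rightarrow> bool" where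
  "weak_solution_in X \<Omega> a b \<phi> F u U \<longleftrightarrow>
     u \<in> X \<and> saturated_section \<Omega> u U \<and> (\<lambda>x. \<phi> x * u x) \<in> Lp \<Omega> 2 \<and>
     (\<forall>v\<in>X. grad_bracket \<Omega> u v + bracket \<Omega> (\<lambda>x. a * U x) v + bracket \<Omega> (\<lambda>x. b * u x) v
              + bracket \<Omega> (\<lambda>x. \<phi> x * u x) v = F v)"

definition dirichlet_weak_solution ::
    "'a::euclidean_space set \<Rightarrow> complex \<Rightarrow> complex \<Rightarrow> ('a \<Rightarrow> complex) \<Rightarrow>
     (('a \<Rightarrow> complex) \<Rightarrow> real) \<Rightarrow> ('a \<Rightarrow> complex) \<Rightarrow> ('a \<Rightarrow> complex) \<Rightarrow> bool" where
  "dirichlet_weak_solution \<Omega> = weak_solution_in (H10 \<Omega> \<inter> Lp \<Omega> 1) \<Omega>"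

definition neumann_weak_solution ::
    "'a::euclidean_space set \<Rightarrow> complex \<Rightarrow> complex \<Rightarrow> ('a \<Rightarrow> complex) \<Rightarrow>
     (('a \<Rightarrow> complex) \<Rightarrow> real) \<Rightarrow> ('a \<Rightarrow> complex) \<Rightarrow> ('a \<Rightarrow> complex) \<Rightarrow> bool" where
  "neumann_weak_solution \<Omega> = weak_solution_in (H1 \<Omega>) \<Omega>"

end

theory Submission
  imports Defs
begin

text \<open>
  The proof is the energy method. Let \<open>u = u\<^sub>1 - u\<^sub>2\<close> and \<open>U = U\<^sub>1 - U\<^sub>2\<close>. The right-hand sides of the
  two equations cancel, and since the test space is stable under multiplication by complex numbers
  \<open>c\<close>, the real identities obtained from \<open>c v\<close> combine into a complex one. With \<open>v = u\<close> it reads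
  \<open>G + a P + Q = 0\<close>, where \<open>G\<close> is the integral of \<open>|\<nabla>u|\<^sup>2\<close>, \<open>P\<close> that of \<open>U cnj u\<close>, and \<open>Q\<close> that of
  \<open>(b + \<phi>)|u|\<^sup>2\<close> (\<open>energy_identity\<close>).

  Multiply by \<open>cnj a\<close> and take real parts: \<open>Re a * G + |a|\<^sup>2 Re P + Re (cnj a * Q) = 0\<close>. The first term is
  nonnegative as \<open>Re a \<ge> 0\<close>, the second because \<open>u \<mapsto> u/|u|\<close> is monotone (\<open>saturation_monotone\<close>), the
  third by the sign condition on \<open>b + \<phi>\<close>. So all of them vanish. Equality in the monotonicity
  inequality forces \<open>U cnj u = 0\<close>, the imaginary part included, hence \<open>P = 0\<close> and \<open>Q = - G\<close>. Thus
  \<open>Re (cnj a * Q) = 0\<close>, \<open>Re Q \<le> 0\<close> and \<open>Im Q = 0\<close>, and each of the alternative hypotheses makes one of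
  these quantities the integral of a function of strict sign times \<open>|u|\<^sup>2\<close>. Therefore \<open>u = 0\<close>
  (\<open>weak_solutions_difference_eq_0\<close>). What remains of the equation is that \<open>a U\<close> is orthogonal to all
  test functions, so that \<open>U = 0\<close>.

  The analytic ingredient is the fundamental lemma of the calculus of variations
  (\<open>AE_eq_0_of_test_functions\<close>). It gives the last step, and the uniqueness of weak derivatives, by
  which the arbitrary representative \<open>weak_partial\<close> depends linearly on the function up to null sets.
  It requires enough test functions, which are built from \<open>exp (-1/t)\<close>. That test functions
  belong to \<open>H\<^sup>1\<^sub>0(\<Omega>)\<close> is integration by parts, here a consequence of the translation invariance of the
  Lebesgue measure.
\<close>

section \<open>Smooth functions\<close>

lemma C_diff_SucD: "C_diff (Suc k) f \<Longrightarrow> C_diff k f"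
proof (induction k arbitrary: f)
  case 0
  then show ?case
    by (auto intro!: differentiable_imp_continuous_on simp: differentiable_on_def differentiable_at_withinI)
next
  case (Suc k)
  then show ?case by simp
qed

lemma C_diff_const: "C_diff k (\<lambda>x. c)"
  by (induction k arbitrary: c) (auto simp: frechet_derivative_const)

lemma C_diff_add: "C_diff k f \<Longrightarrow> C_diff k g \<Longrightarrow> C_diff k (\<lambda>x. f x + g x)"
proof (induction k arbitrary: f g)
  case 0
  then show ?case by (auto intro: continuous_intros)
next
  case (Suc k)
  then have "frechet_derivative (\<lambda>x. f x + g x) (at x) i =
      frechet_derivative f (at x) i + frechet_derivative g (at x) i" for x i
    by (auto simp: frechet_derivative_works
        intro!: fun_cong[OF frechet_derivative_at[symmetric]] has_derivative_add)
  with Suc show ?case by simp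
qed

lemma frechet_derivative_mult_at:
  fixes f g :: "'a::euclidean_space \<Rightarrow> complex"
  assumes "f differentiable (at x)" "g differentiable (at x)"
  shows "frechet_derivative (\<lambda>x. f x * g x) (at x) i =
      f x * frechet_derivative g (at x) i + frechet_derivative f (at x) i * g x"
proof -
  have "((\<lambda>x. f x * g x) has_derivative
     (\<lambda>h. f x * frechet_derivative g (at x) h + frechet_derivative f (at x) h * g x)) (at x)"
    using assms by (intro has_derivative_mult) (auto simp: frechet_derivative_works)
  from frechet_derivative_at[OF this] show ?thesis by metis
qed

lemma C_diff_mult: "C_diff k f \<Longrightarrow> C_diff k g \<Longrightarrow> C_diff k (\<lambda>x. f x * g x)"
proof (induction k arbitrary: f g)
  case 0
  then show ?case by (auto intro: continuous_intros)
next
  case (Suc k)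
  have "C_diff k f" "C_diff k g"
    using Suc.prems C_diff_SucD by blast+
  with Suc show ?case
    by (auto simp: frechet_derivative_mult_at differentiable_mult intro!: C_diff_add)
qed

lemma C_diff_prod: "finite I \<Longrightarrow> (\<And>i. i \<in> I \<Longrightarrow> C_diff k (f i)) \<Longrightarrow> C_diff k (\<lambda>x. \<Prod>i\<in>I. f i x)"
  by (induction I rule: finite_induct) (auto intro: C_diff_const C_diff_mult)

text \<open>
  The family \<open>q(1/t) exp (-1/t)\<close>, extended by 0 to \<open>t \<le> 0\<close>, contains the classical smooth function
  \<open>exp (-1/t)\<close>. Allowing a polynomial factor makes the family stable under differentiation, so that a
  single differentiation rule yields smoothness of every order.
\<close>

definition exp_profile :: "real poly \<Rightarrow> real \<Rightarrow> real" where
  "exp_profile q t = (if t \<le> 0 then 0 else poly q (1 / t) * exp (- (1 / t)))"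

lemma tendsto_poly_exp_neg: "((\<lambda>s. poly q s * exp (- s)) \<longlongrightarrow> (0::real)) at_top"
proof -
  have "((\<lambda>s. \<Sum>i\<le>degree q. coeff q i * (s ^ i / exp s)) \<longlongrightarrow> (\<Sum>i\<le>degree q. coeff q i * 0)) at_top"
    by (intro tendsto_intros tendsto_power_div_exp_0)
  then show ?thesis
    by (simp add: poly_altdef sum_distrib_right exp_minus divide_inverse mult.assoc)
qed

lemma exp_profile_tendsto_0: "(exp_profile q \<longlongrightarrow> 0) (at_right 0)"
proof -
  have "((\<lambda>t. poly q (inverse t) * exp (- inverse t)) \<longlongrightarrow> 0) (at_right 0)"
    by (rule filterlim_compose[OF tendsto_poly_exp_neg filterlim_inverse_at_top_right])
  moreover have "eventually (\<lambda>t. poly q (inverse t) * exp (- inverse t) = exp_profile q t) (at_right 0)"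
    by (auto simp: eventually_at_right_field exp_profile_def inverse_eq_divide intro!: exI[of _ 1])
  ultimately show ?thesis
    by (rule Lim_transform_eventually)
qed

text \<open>
  For \<open>t > 0\<close> and \<open>s = 1/t\<close>, the chain rule gives \<open>-s\<^sup>2 q'(s) exp (-s) + s\<^sup>2 q(s) exp (-s)\<close>.
  At 0 the difference quotient from the right is again a member of the family, with \<open>q\<close> multiplied by
  the variable, and members of the family tend to 0.
\<close>

lemma has_derivative_exp_profile:
  "(exp_profile q has_real_derivative exp_profile ([:0, 0, 1:] * (q - pderiv q)) t) (at t)"
proof -
  consider "t < 0" | "t = 0" | "t > 0" by linarith
  then show ?thesis
  proof cases
    case 1
    have "((\<lambda>t::real. 0::real) has_real_derivative 0) (at t)" by simp
    then have "(exp_profile q has_real_derivative 0) (at t)"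
      by (rule has_field_derivative_transform_within_open[where S = "{..<0}"])
        (use 1 in \<open>auto simp: exp_profile_def\<close>)
    then show ?thesis using 1 by (simp add: exp_profile_def)
  next
    case 3
    have "((\<lambda>t. poly q (1 / t) * exp (- (1 / t))) has_real_derivative
        exp_profile ([:0, 0, 1:] * (q - pderiv q)) t) (at t)"
      using 3 by (auto intro!: derivative_eq_intros poly_DERIV[THEN DERIV_chain2]
          simp: exp_profile_def field_simps power2_eq_square)
    then show ?thesis
      by (rule has_field_derivative_transform_within_open[where S = "{0<..}"])
        (use 3 in \<open>auto simp: exp_profile_def\<close>)
  next
    case 2
    have "((\<lambda>h. exp_profile q h / h) \<longlongrightarrow> 0) (at 0)"
    proof (rule filterlim_split_at)
      show "((\<lambda>h. exp_profile q h / h) \<longlongrightarrow> 0) (at_left 0)"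
        by (rule Lim_transform_eventually[OF tendsto_const])
          (auto simp: eventually_at_left_field exp_profile_def intro!: exI[of _ "-1"])
      show "((\<lambda>h. exp_profile q h / h) \<longlongrightarrow> 0) (at_right 0)"
        by (rule Lim_transform_eventually[OF exp_profile_tendsto_0[of "[:0, 1:] * q"]])
          (auto simp: eventually_at_right_field exp_profile_def intro!: exI[of _ 1])
    qed
    then have "(exp_profile q has_real_derivative 0) (at 0)"
      by (simp add: DERIV_def exp_profile_def)
    then show ?thesis using 2 by (simp add: exp_profile_def)
  qed
qed

lemma C_diff_exp_profile: "C_diff k (\<lambda>x. complex_of_real (exp_profile q (x \<bullet> v + r)))"
proof (induction k arbitrary: q)
  case 0
  have "continuous_on UNIV (exp_profile q)"
    using has_derivative_exp_profile DERIV_isCont continuous_at_imp_continuous_on by blast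
  then have "continuous_on UNIV (\<lambda>x. exp_profile q (x \<bullet> v + r))"
    by (rule continuous_on_compose2) (auto intro!: continuous_intros)
  then show ?case by (simp add: continuous_on_of_real)
next
  case (Suc k)
  let ?q = "[:0, 0, 1:] * (q - pderiv q)"
  have d: "((\<lambda>x. complex_of_real (exp_profile q (x \<bullet> v + r))) has_derivative
      (\<lambda>h. complex_of_real (exp_profile ?q (x \<bullet> v + r) * (h \<bullet> v)))) (at x)" for x
  proof -
    have "(exp_profile q has_derivative (*) (exp_profile ?q (x \<bullet> v + r))) (at (x \<bullet> v + r))"
      using has_derivative_exp_profile has_field_derivative_def by blast
    then have "((\<lambda>x. exp_profile q (x \<bullet> v + r)) has_derivative
        (\<lambda>h. exp_profile ?q (x \<bullet> v + r) * (h \<bullet> v))) (at x)"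
      by (rule has_derivative_compose[rotated]) (auto intro!: derivative_eq_intros)
    then show ?thesis by (rule has_derivative_of_real)
  qed
  have "frechet_derivative (\<lambda>x. complex_of_real (exp_profile q (x \<bullet> v + r))) (at x) i =
      complex_of_real (exp_profile ?q (x \<bullet> v + r)) * complex_of_real (i \<bullet> v)" for x i
    using frechet_derivative_at[OF d[of x], symmetric] by simp
  moreover have "(\<lambda>x. complex_of_real (exp_profile q (x \<bullet> v + r))) differentiable (at x)" for x
    using d differentiable_def by blast
  ultimately show ?case
    using Suc by (simp del: mult_pCons_left of_real_mult add: C_diff_mult C_diff_const)
qed

text \<open>
  Positive exactly on the open box, and increasing with \<open>n\<close> to its indicator:
  \<open>exp (-1/((n+1) t))\<close> tends to 1 for each \<open>t > 0\<close>.
\<close>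

definition box_bump :: "'a::euclidean_space \<Rightarrow> 'a \<Rightarrow> nat \<Rightarrow> 'a \<Rightarrow> complex" where
  "box_bump c d n x = (\<Prod>i\<in>Basis.
     complex_of_real (exp_profile 1 (real (Suc n) * (x \<bullet> i - c \<bullet> i))) *
     complex_of_real (exp_profile 1 (real (Suc n) * (d \<bullet> i - x \<bullet> i))))"

lemma exp_profile_1_le_1: "0 \<le> exp_profile 1 t" "exp_profile 1 t \<le> 1"
  by (auto simp: exp_profile_def)

lemma exp_profile_1_eq_0_iff: "exp_profile 1 t = 0 \<longleftrightarrow> t \<le> 0"
  by (auto simp: exp_profile_def)

lemma exp_profile_1_tendsto:
  "(\<lambda>n. exp_profile 1 (real (Suc n) * t)) \<longlonglongrightarrow> (if t > 0 then 1 else 0)"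
proof (cases "t > 0")
  case True
  have "(\<lambda>n. exp (- (inverse (real (Suc n)) * inverse t))) \<longlonglongrightarrow> exp (- (0 * inverse t))"
    by (intro tendsto_intros LIMSEQ_inverse_real_of_nat)
  moreover have "exp_profile 1 (real (Suc n) * t) = exp (- (inverse (real (Suc n)) * inverse t))" for n
    using True by (auto simp: exp_profile_def divide_simps mult_le_0_iff)
  ultimately show ?thesis using True by simp
next
  case False
  then have "exp_profile 1 (real (Suc n) * t) = 0" for n
    by (simp only: exp_profile_1_eq_0_iff) (simp add: mult_le_0_iff)
  with False show ?thesis by simp
qed

lemma C_diff_box_bump: "C_diff k (box_bump c d n)"
proof -
  have "C_diff k (\<lambda>x. complex_of_real (exp_profile 1 (real (Suc n) * (x \<bullet> i - c \<bullet> i))))" for i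
    using C_diff_exp_profile[of k 1 "real (Suc n) *\<^sub>R i" "- (real (Suc n) * (c \<bullet> i))"]
    by (simp only: inner_scaleR_right right_diff_distrib add_uminus_conv_diff)
  moreover have "C_diff k (\<lambda>x. complex_of_real (exp_profile 1 (real (Suc n) * (d \<bullet> i - x \<bullet> i))))" for i
    using C_diff_exp_profile[of k 1 "- (real (Suc n) *\<^sub>R i)" "real (Suc n) * (d \<bullet> i)"]
    by (simp only: inner_scaleR_right inner_minus_right right_diff_distrib add_uminus_conv_diff
        uminus_add_conv_diff)
  ultimately show ?thesis
    unfolding box_bump_def by (intro C_diff_prod C_diff_mult) auto
qed

lemma box_bump_eq_0_iff: "box_bump c d n x = 0 \<longleftrightarrow> x \<notin> box c d"
  by (auto simp: box_bump_def exp_profile_1_eq_0_iff mem_box mult_le_0_iff not_less)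

lemma norm_box_bump_le_1: "norm (box_bump c d n x) \<le> 1"
  unfolding box_bump_def prod_norm[symmetric]
  by (intro prod_le_1 conjI) (auto simp: norm_mult abs_of_nonneg exp_profile_1_le_1 simp del: of_nat_Suc intro!: mult_le_one)

lemma box_bump_tendsto: "(\<lambda>n. box_bump c d n x) \<longlonglongrightarrow> indicator (box c d) x"
proof -
  let ?l = "\<Prod>i\<in>Basis. complex_of_real (if x \<bullet> i - c \<bullet> i > 0 then 1 else 0) *
     complex_of_real (if d \<bullet> i - x \<bullet> i > 0 then 1 else 0)"
  have "(\<lambda>n. box_bump c d n x) \<longlonglongrightarrow> ?l"
    unfolding box_bump_def by (intro tendsto_prod tendsto_mult tendsto_of_real exp_profile_1_tendsto)
  moreover have "?l = indicator (box c d) x"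
  proof (cases "x \<in> box c d")
    case True
    then show ?thesis by (simp add: mem_box)
  next
    case False
    then obtain i where "i \<in> Basis" "\<not> (c \<bullet> i < x \<bullet> i \<and> x \<bullet> i < d \<bullet> i)"
      by (auto simp: mem_box)
    then show ?thesis using False by (auto intro!: prod_zero)
  qed
  ultimately show ?thesis by simp
qed

lemma cnj_box_bump: "cnj (box_bump c d n x) = box_bump c d n x"
  by (simp add: box_bump_def)

lemma box_bump_test_function:
  assumes "cbox c d \<subseteq> \<Omega>"
  shows "box_bump c d n \<in> test_functions \<Omega>"
proof -
  have "closure {x. box_bump c d n x \<noteq> 0} \<subseteq> cbox c d"
    by (rule closure_minimal) (auto simp: box_bump_eq_0_iff closed_cbox dest: box_subset_cbox[THEN subsetD])
  then show ?thesis
    using assms compact_Int_closed[OF compact_cbox closed_closure, of c d "{x. box_bump c d n x \<noteq> 0}"]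
    by (auto simp: test_functions_def C_diff_box_bump Int_absorb1)
qed


section \<open>The fundamental lemma of the calculus of variations\<close>

lemma lebesgue_on_vanishing_outside:
  fixes h :: "'a::euclidean_space \<Rightarrow> 'b::{banach, second_countable_topology}"
  assumes "S \<in> sets lebesgue" "\<Omega> \<in> sets lebesgue" "S \<subseteq> \<Omega>" "\<And>x. x \<in> \<Omega> - S \<Longrightarrow> h x = 0"
  shows "integrable (lebesgue_on \<Omega>) h \<longleftrightarrow> integrable (lebesgue_on S) h"
    and "integral\<^sup>L (lebesgue_on \<Omega>) h = integral\<^sup>L (lebesgue_on S) h"
proof -
  have *: "(\<lambda>x. indicator \<Omega> x *\<^sub>R h x) = (\<lambda>x. indicator S x *\<^sub>R h x)"
    using assms by (auto simp: indicator_def fun_eq_iff)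
  then show "integrable (lebesgue_on \<Omega>) h \<longleftrightarrow> integrable (lebesgue_on S) h"
    "integral\<^sup>L (lebesgue_on \<Omega>) h = integral\<^sup>L (lebesgue_on S) h"
    using assms by (simp_all add: integrable_restrict_space integral_restrict_space *)
qed

lemma integrable_lebesgue_on_subset:
  fixes h :: "'a::euclidean_space \<Rightarrow> 'b::{banach, second_countable_topology}"
  assumes "integrable (lebesgue_on T) h" "S \<in> sets lebesgue" "T \<in> sets lebesgue" "S \<subseteq> T"
  shows "integrable (lebesgue_on S) h"
  using assms set_integrable_subset[of lebesgue T h S]
  by (simp add: integrable_restrict_space set_integrable_def)

lemma continuous_on_compact_integrable:
  fixes h :: "'a::euclidean_space \<Rightarrow> 'b::euclidean_space"
  assumes "compact K" "continuous_on K h"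
  shows "integrable (lebesgue_on K) h"
proof -
  have K: "K \<in> lmeasurable" using assms(1) by (rule lmeasurable_compact)
  then interpret finite_measure "lebesgue_on K" by (rule finite_measure_lebesgue_on)
  have "bounded (h ` K)"
    using assms compact_continuous_image compact_imp_bounded by blast
  then obtain C where "\<And>x. x \<in> K \<Longrightarrow> norm (h x) \<le> C"
    by (auto simp: bounded_iff)
  moreover have "h \<in> borel_measurable (lebesgue_on K)"
    using K assms(2) by (simp add: continuous_imp_measurable_on_sets_lebesgue fmeasurableD)
  ultimately show ?thesis
    by (intro integrable_const_bound[of _ C]) auto
qed

lemma L1_loc_mult_test_function_integrable:
  assumes "open \<Omega>" "f \<in> L1_loc \<Omega>" "\<psi> \<in> test_functions \<Omega>"
  shows "integrable (lebesgue_on \<Omega>) (\<lambda>x. f x * \<psi> x)"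
proof -
  let ?K = "closure {x. \<psi> x \<noteq> 0}"
  have K: "compact ?K" "?K \<subseteq> \<Omega>" and "C_diff 0 \<psi>"
    using assms(3) by (auto simp: test_functions_def)
  then have cont: "continuous_on ?K \<psi>"
    by (auto intro: continuous_on_subset)
  have zero: "\<psi> x = 0" if "x \<notin> ?K" for x
    using that closure_subset[of "{x. \<psi> x \<noteq> 0}"] by blast
  have int_f: "integrable (lebesgue_on ?K) f"
    using assms(2) K by (auto simp: L1_loc_def)
  obtain C where C: "\<And>x. x \<in> ?K \<Longrightarrow> norm (\<psi> x) \<le> C"
    using compact_continuous_image[OF cont K(1)] compact_imp_bounded by (fastforce simp: bounded_iff)
  have "\<psi> \<in> borel_measurable (lebesgue_on ?K)"
    using continuous_on_compact_integrable[OF K(1) cont] by auto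
  then have meas: "(\<lambda>x. f x * \<psi> x) \<in> borel_measurable (lebesgue_on ?K)"
    using int_f by (intro borel_measurable_times) auto
  have "norm (f x * \<psi> x) \<le> norm (of_real C * f x)" if "x \<in> ?K" for x
    using mult_right_mono[OF order_trans[OF C[OF that] abs_ge_self] norm_ge_zero[of "f x"]]
    by (simp add: norm_mult mult.commute)
  then have "AE x in lebesgue_on ?K. norm (f x * \<psi> x) \<le> norm (of_real C * f x)"
    by (intro AE_I2) (simp only: space_lebesgue_on)
  then have "integrable (lebesgue_on ?K) (\<lambda>x. f x * \<psi> x)"
    by (rule Bochner_Integration.integrable_bound[OF integrable_mult_right[OF int_f] meas])
  moreover have "f x * \<psi> x = 0" if "x \<in> \<Omega> - ?K" for x
    using zero[of x] that by (metis DiffD2 mult_zero_right)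
  ultimately show ?thesis
    using K assms(1)
    by (subst lebesgue_on_vanishing_outside(1)[of ?K]) (simp_all only: lmeasurable_compact fmeasurableD lebesgue_openin open_openin borel_open sets_completionI_sets sets_lborel)
qed

text \<open>
  The bumps converge boundedly to the indicator of the open box, whose frontier is a null set.
  Only real-valued test functions are required to be orthogonal, because the bumps are real.
\<close>

lemma integral_cbox_eq_0_of_test_functions:
  assumes "open \<Omega>" "f \<in> L1_loc \<Omega>"
    and orth: "\<And>\<psi>. \<psi> \<in> test_functions \<Omega> \<Longrightarrow> (\<And>x. cnj (\<psi> x) = \<psi> x) \<Longrightarrow>
        (LINT x|lebesgue_on \<Omega>. f x * \<psi> x) = 0"
    and sub: "cbox c d \<subseteq> \<Omega>"
  shows "integral (cbox c d) f = 0"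
proof -
  have f: "integrable (lebesgue_on (box c d)) f"
  proof (rule integrable_lebesgue_on_subset)
    show "integrable (lebesgue_on (cbox c d)) f"
      using assms sub by (auto simp: L1_loc_def)
  qed (auto simp: box_subset_cbox)
  have meas: "box_bump c d n \<in> borel_measurable (lebesgue_on (box c d))" for n
  proof -
    have "continuous_on UNIV (box_bump c d n)"
      using C_diff_box_bump[of 0 c d n] by simp
    then show ?thesis
      by (intro continuous_imp_measurable_on_sets_lebesgue) (auto intro: continuous_on_subset)
  qed
  have "(\<lambda>n. LINT x|lebesgue_on (box c d). f x * box_bump c d n x)
      \<longlonglongrightarrow> (LINT x|lebesgue_on (box c d). f x)"
  proof (rule integral_dominated_convergence[where w = "\<lambda>x. norm (f x)"])
    show "AE x in lebesgue_on (box c d). (\<lambda>n. f x * box_bump c d n x) \<longlonglongrightarrow> f x"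
    proof (rule AE_I2)
      fix x assume "x \<in> space (lebesgue_on (box c d))"
      then show "(\<lambda>n. f x * box_bump c d n x) \<longlonglongrightarrow> f x"
        using tendsto_mult[OF tendsto_const[of "f x"] box_bump_tendsto[of c d x]] by simp
    qed
    show "AE x in lebesgue_on (box c d). norm (f x * box_bump c d n x) \<le> norm (f x)" for n
      by (auto simp: norm_mult intro!: mult_left_le norm_box_bump_le_1)
  qed (use f meas in auto)
  moreover have "(LINT x|lebesgue_on (box c d). f x * box_bump c d n x) = 0" for n
  proof -
    have "(LINT x|lebesgue_on \<Omega>. f x * box_bump c d n x) =
        (LINT x|lebesgue_on (box c d). f x * box_bump c d n x)"
    proof (rule lebesgue_on_vanishing_outside(2))
      show "box c d \<subseteq> \<Omega>" using sub box_subset_cbox[of c d] by blast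
    qed (use assms(1) in \<open>auto simp: box_bump_eq_0_iff\<close>)
    then show ?thesis
      using orth[OF box_bump_test_function[OF sub] cnj_box_bump] by simp
  qed
  ultimately have "(LINT x|lebesgue_on (box c d). f x) = 0"
    by (simp add: LIMSEQ_const_iff)
  then show ?thesis
    using f by (simp add: lebesgue_integral_eq_integral integral_open_interval)
qed

text \<open>
  The fundamental lemma of the calculus of variations. By Lebesgue's differentiation theorem, almost
  every value of \<open>f\<close> is the limit of the means of \<open>f\<close> over shrinking cubes, and these are 0.
\<close>

lemma AE_eq_0_of_test_functions:
  assumes "open \<Omega>" "f \<in> L1_loc \<Omega>"
    and orth: "\<And>\<psi>. \<psi> \<in> test_functions \<Omega> \<Longrightarrow> (\<And>x. cnj (\<psi> x) = \<psi> x) \<Longrightarrow>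
        (LINT x|lebesgue_on \<Omega>. f x * \<psi> x) = 0"
  shows "AE x in lebesgue_on \<Omega>. f x = 0"
proof -
  have neg: "negligible {x \<in> box c d. f x \<noteq> 0}" if sub: "cbox c d \<subseteq> \<Omega>" for c d
  proof -
    let ?F = "\<lambda>x. if x \<in> cbox c d then f x else 0"
    have "integrable (lebesgue_on (cbox c d)) f"
      using assms(2) sub by (auto simp: L1_loc_def)
    then have "f integrable_on cbox c d"
      by (auto intro: integrable_on_lebesgue_on)
    then have "?F integrable_on cbox p q" for p q
      by (rule integrable_altD(1))
    then obtain N where N: "negligible N"
      and lim: "\<And>x e. \<lbrakk>x \<notin> N; 0 < e\<rbrakk> \<Longrightarrow> \<exists>\<delta>>0. \<forall>h. 0 < h \<and> h < \<delta> \<longrightarrow>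
           norm (integral (cbox x (x + h *\<^sub>R One)) ?F /\<^sub>R h ^ DIM('a) - ?F x) < e"
      by (rule integrable_ccontinuous_explicit) blast
    have "f x = 0" if x: "x \<in> box c d" "x \<notin> N" for x
    proof (rule ccontr)
      assume "f x \<noteq> 0"
      then obtain \<delta> where "\<delta> > 0" and \<delta>: "\<And>h. 0 < h \<Longrightarrow> h < \<delta> \<Longrightarrow>
           norm (integral (cbox x (x + h *\<^sub>R One)) ?F /\<^sub>R h ^ DIM('a) - ?F x) < norm (f x)"
        using lim[of x "norm (f x)"] x by auto
      \<comment> \<open>A side length \<open>h\<close> of at most \<open>m\<close> keeps the cube with lower corner \<open>x\<close> inside the box.\<close>
      define m where "m = Min ((\<lambda>i. (d - x) \<bullet> i) ` Basis)"
      have "m > 0" using x by (auto simp: m_def mem_box inner_diff_left)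
      define h where "h = min m \<delta> / 2"
      have h: "0 < h" "h < \<delta>" "h \<le> m" using \<open>m > 0\<close> \<open>\<delta> > 0\<close> by (auto simp: h_def min_def)
      have "h \<le> (d - x) \<bullet> i" if "i \<in> Basis" for i
        using that h(3) unfolding m_def by (auto intro: order_trans)
      then have hsub: "cbox x (x + h *\<^sub>R One) \<subseteq> cbox c d"
        using x(1) by (intro subset_box_imp) (auto simp: mem_box inner_add_left inner_diff_left le_diff_eq add.commute less_imp_le)
      have "integral (cbox x (x + h *\<^sub>R One)) ?F = integral (cbox x (x + h *\<^sub>R One)) f"
        using hsub by (intro integral_cong) auto
      also have "\<dots> = 0"
        using hsub sub by (intro integral_cbox_eq_0_of_test_functions[OF assms]) auto
      finally show False
        using \<delta>[OF h(1,2)] x box_subset_cbox[of c d] by auto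
    qed
    then have "{x \<in> box c d. f x \<noteq> 0} \<subseteq> N" by auto
    then show ?thesis using N negligible_subset by blast
  qed
  have "negligible {x \<in> \<Omega>. f x \<noteq> 0}"
  proof (rule iffD2[OF locally_negligible_alt], intro ballI)
    fix x assume x: "x \<in> {x \<in> \<Omega>. f x \<noteq> 0}"
    then have "x \<in> \<Omega>" by simp
    then obtain c d where cd: "cbox c d \<subseteq> \<Omega>" "x \<in> box c d"
      by (rule open_contains_cbox[OF assms(1)])
    have "openin (top_of_set {x \<in> \<Omega>. f x \<noteq> 0}) ({x \<in> \<Omega>. f x \<noteq> 0} \<inter> box c d)"
      by (intro openin_open_Int open_box)
    moreover have "negligible ({x \<in> \<Omega>. f x \<noteq> 0} \<inter> box c d)"
      using neg[OF cd(1)] by (rule negligible_subset) auto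
    ultimately show "\<exists>U. openin (top_of_set {x \<in> \<Omega>. f x \<noteq> 0}) U \<and> x \<in> U \<and> negligible U"
      using x cd by blast
  qed
  then have "{x \<in> \<Omega>. f x \<noteq> 0} \<in> null_sets lebesgue"
    by (simp only: negligible_iff_null_sets)
  then have "AE x in lebesgue. x \<in> \<Omega> \<longrightarrow> f x = 0"
    by (rule AE_I') auto
  then show ?thesis
    using assms(1) by (simp add: AE_restrict_space_iff)
qed

section \<open>Integration by parts against a test function\<close>

lemma compact_support_bound:
  fixes f :: "'a::euclidean_space \<Rightarrow> complex"
  assumes "continuous_on UNIV f" "compact (closure {x. f x \<noteq> 0})"
  obtains B R where "0 \<le> B" "0 \<le> R" "\<And>x. norm (f x) \<le> B" "\<And>x. R < norm x \<Longrightarrow> f x = 0"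
proof -
  let ?K = "closure {x. f x \<noteq> 0}"
  obtain R where R: "\<And>x. x \<in> ?K \<Longrightarrow> norm x \<le> R"
    using compact_imp_bounded[OF assms(2)] by (auto simp: bounded_iff)
  have "bounded (f ` ?K)"
    by (intro compact_imp_bounded compact_continuous_image assms(2) continuous_on_subset[OF assms(1)]) auto
  then obtain B where B: "\<And>x. x \<in> ?K \<Longrightarrow> norm (f x) \<le> B"
    by (auto simp: bounded_iff)
  have K: "x \<in> ?K" if "f x \<noteq> 0" for x
    using that closure_subset[of "{x. f x \<noteq> 0}"] by auto
  show ?thesis
  proof (rule that[of "max B 0" "max R 0"])
    show "norm (f x) \<le> max B 0" for x
      by (cases "f x = 0") (simp, metis B K max.coboundedI1)
    show "f x = 0" if "max R 0 < norm x" for x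
      using that by (metis R K max_less_iff_conj not_le)
  qed auto
qed

lemma integral_lborel_translate:
  fixes f :: "'a::euclidean_space \<Rightarrow> complex"
  assumes "f \<in> borel_measurable borel"
  shows "(LINT x|lborel. f (x + c)) = (LINT x|lborel. f x)"
proof -
  have "(LINT x|lborel. f x) = (LINT x|distr lborel borel ((+) c). f x)"
    by (simp add: lborel_distr_plus)
  also have "\<dots> = (LINT x|lborel. f (c + x))"
    using assms by (subst integral_distr) auto
  finally show ?thesis by (simp add: add.commute)
qed

text \<open>
  The difference quotients of \<open>f\<close> in the direction \<open>i\<close> have integral 0 because the measure is
  invariant under translation; they are bounded by the maximum of the derivative, vanish outside
  a fixed ball, and converge to the derivative.
\<close>

lemma integral_partial_derivative_eq_0:
  fixes f :: "'a::euclidean_space \<Rightarrow> complex"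
  assumes diff: "\<And>x. f differentiable (at x)"
    and i: "i \<in> Basis"
    and cont: "continuous_on UNIV (\<lambda>x. frechet_derivative f (at x) i)"
    and supp: "compact (closure {x. f x \<noteq> 0})" "compact (closure {x. frechet_derivative f (at x) i \<noteq> 0})"
  shows "(LINT x|lebesgue. frechet_derivative f (at x) i) = 0"
proof -
  let ?D = "\<lambda>x. frechet_derivative f (at x) i"
  define h :: "nat \<Rightarrow> real" where "h n = inverse (real (Suc n))" for n
  have h: "0 < h n" "h n \<le> 1" for n
    by (auto simp: h_def divide_simps)
  have contf: "continuous_on UNIV f"
    using diff by (simp add: differentiable_imp_continuous_on differentiable_on_def differentiable_at_withinI)
  have mf: "f \<in> borel_measurable borel" using contf by (rule borel_measurable_continuous_onI)
  have mD: "?D \<in> borel_measurable borel" using cont by (rule borel_measurable_continuous_onI)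
  obtain Bf R where f: "0 \<le> Bf" "0 \<le> R" "\<And>x. norm (f x) \<le> Bf" "\<And>x. R < norm x \<Longrightarrow> f x = 0"
    using compact_support_bound[OF contf supp(1)] by blast
  obtain B R' where D: "0 \<le> B" "\<And>x. norm (?D x) \<le> B"
    using compact_support_bound[OF cont supp(2)] by metis
  have int_ind: "integrable lborel (\<lambda>x. C * indicator (cball 0 r) x :: real)" for C r
    by (intro integrable_mult_right integrable_real_indicator emeasure_bounded_finite) auto
  have int_f: "integrable lborel f"
    by (rule Bochner_Integration.integrable_bound[OF int_ind[of Bf R]])
      (use f mf in \<open>auto simp: indicator_def not_le\<close>)
  have deriv: "((\<lambda>t. f (x + t *\<^sub>R i)) has_derivative (\<lambda>s. s *\<^sub>R ?D (x + t *\<^sub>R i))) (at t)" for x t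
  proof -
    have "(f has_derivative frechet_derivative f (at (x + t *\<^sub>R i))) (at (x + t *\<^sub>R i))"
      using diff frechet_derivative_works by blast
    then have "((\<lambda>t. f (x + t *\<^sub>R i)) has_derivative
        (\<lambda>s. frechet_derivative f (at (x + t *\<^sub>R i)) (s *\<^sub>R i))) (at t)"
      by (rule has_derivative_compose[rotated]) (auto intro!: derivative_eq_intros)
    then show ?thesis
      using linear_frechet_derivative[OF diff] by (simp add: linear_cmul)
  qed
  define g where "g n x = (f (x + h n *\<^sub>R i) - f x) /\<^sub>R h n" for n x
  have "(\<lambda>n. LINT x|lborel. g n x) \<longlonglongrightarrow> (LINT x|lborel. ?D x)"
  proof (rule integral_dominated_convergence[where w = "\<lambda>x. B * indicator (cball 0 (R + 1)) x"])
    show "?D \<in> borel_measurable lborel" using mD by simp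
    show "g n \<in> borel_measurable lborel" for n
      unfolding g_def using mf by measurable
    show "integrable lborel (\<lambda>x. B * indicator (cball 0 (R + 1)) x :: real)"
      by (rule int_ind)
    show "AE x in lborel. (\<lambda>n. g n x) \<longlonglongrightarrow> ?D x"
    proof (rule AE_I2)
      fix x
      have "((\<lambda>s. norm (f (x + s *\<^sub>R i) - f x - s *\<^sub>R ?D x) / norm s) \<longlongrightarrow> 0) (at 0)"
        using deriv[of x 0] by (simp add: has_derivative_at)
      moreover have "filterlim h (at 0) sequentially"
        using h LIMSEQ_inverse_real_of_nat unfolding filterlim_at h_def
        by (auto intro!: always_eventually)
      ultimately have "(\<lambda>n. norm (f (x + h n *\<^sub>R i) - f x - h n *\<^sub>R ?D x) / norm (h n)) \<longlonglongrightarrow> 0"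
        by (rule filterlim_compose)
      moreover have "norm (f (x + h n *\<^sub>R i) - f x - h n *\<^sub>R ?D x) / norm (h n) = norm (g n x - ?D x)" for n
      proof -
        have "f (x + h n *\<^sub>R i) - f x - h n *\<^sub>R ?D x = h n *\<^sub>R (g n x - ?D x)"
          using h(1)[of n] by (simp add: g_def scaleR_diff_right)
        then show ?thesis using h(1)[of n] by simp
      qed
      ultimately show "(\<lambda>n. g n x) \<longlonglongrightarrow> ?D x"
        by (simp add: tendsto_norm_zero_iff LIM_zero_iff)
    qed
    show "AE x in lborel. norm (g n x) \<le> B * indicator (cball 0 (R + 1)) x" for n
    proof (rule AE_I2)
      fix x
      \<comment> \<open>The mean value inequality along the line \<open>x + t i\<close>.\<close>
      have "norm (f (x + h n *\<^sub>R i) - f (x + 0 *\<^sub>R i)) \<le> B * norm (h n - 0)"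
      proof (rule differentiable_bound[where S = UNIV])
        show "onorm (\<lambda>s. s *\<^sub>R ?D (x + t *\<^sub>R i)) \<le> B" for t
          using D(2)[of "x + t *\<^sub>R i"] D(1)
          by (intro onorm_le) (simp add: mult.commute[of B] mult_left_mono)
      qed (use deriv in auto)
      then have bd: "norm (g n x) \<le> B"
        using h(1)[of n] by (simp add: g_def divide_simps mult.commute)
      show "norm (g n x) \<le> B * indicator (cball 0 (R + 1)) x"
      proof (cases "x \<in> cball 0 (R + 1)")
        case True
        then show ?thesis using bd by simp
      next
        case False
        then have "R + 1 < norm x" by simp
        moreover have "norm x \<le> norm (x + h n *\<^sub>R i) + norm (h n *\<^sub>R i)"
          using norm_triangle_ineq4[of "x + h n *\<^sub>R i" "h n *\<^sub>R i"] by simp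
        ultimately have "R < norm x" "R < norm (x + h n *\<^sub>R i)"
          using h[of n] i f(2) by auto
        then show ?thesis using f(4) D(1) by (simp add: g_def)
      qed
    qed
  qed
  moreover have "(LINT x|lborel. g n x) = 0" for n
  proof -
    have "(LINT x|lborel. f (x + h n *\<^sub>R i)) = (LINT x|lborel. f x)"
      using mf by (rule integral_lborel_translate)
    moreover have "integrable lborel (\<lambda>x. f (x + h n *\<^sub>R i))"
    proof (rule Bochner_Integration.integrable_bound[OF int_ind[of Bf "R + 1"]])
      have "f (x + h n *\<^sub>R i) = 0" if "R + 1 < norm x" for x
      proof -
        have "norm x \<le> norm (x + h n *\<^sub>R i) + norm (h n *\<^sub>R i)"
          using norm_triangle_ineq4[of "x + h n *\<^sub>R i" "h n *\<^sub>R i"] by simp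
        then show ?thesis using h[of n] i that by (intro f(4)) auto
      qed
      then show "AE x in lborel. norm (f (x + h n *\<^sub>R i)) \<le> norm (Bf * indicator (cball 0 (R + 1)) x)"
        using f by (auto simp: indicator_def not_le)
    qed (use mf in measurable)
    ultimately show ?thesis
      using int_f by (simp add: g_def)
  qed
  ultimately have "(LINT x|lborel. ?D x) = 0"
    by (simp add: LIMSEQ_const_iff)
  then show ?thesis
    using mD by (simp add: integral_completion)
qed


section \<open>Test functions and weak derivatives\<close>

lemma test_function_continuous: "\<psi> \<in> test_functions \<Omega> \<Longrightarrow> continuous_on S \<psi>"
  unfolding test_functions_def using C_diff.simps(1) continuous_on_subset by blast

lemma test_function_differentiable: "\<psi> \<in> test_functions \<Omega> \<Longrightarrow> \<psi> differentiable (at x)"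
  unfolding test_functions_def using C_diff.simps(2)[of 0 \<psi>] by blast

lemma test_function_zero_outside: "x \<notin> closure {x. \<psi> x \<noteq> 0} \<Longrightarrow> \<psi> x = 0"
  using closure_subset[of "{x. \<psi> x \<noteq> 0}"] by blast

lemma test_function_smaller_support:
  assumes "\<psi> \<in> test_functions \<Omega>" "\<And>k. C_diff k \<eta>" "{x. \<eta> x \<noteq> 0} \<subseteq> closure {x. \<psi> x \<noteq> 0}"
  shows "\<eta> \<in> test_functions \<Omega>"
proof -
  have sub: "closure {x. \<eta> x \<noteq> 0} \<subseteq> closure {x. \<psi> x \<noteq> 0}"
    using assms(3) by (rule closure_minimal) simp
  moreover have "compact (closure {x. \<eta> x \<noteq> 0})"
  proof -
    have "compact (closure {x. \<psi> x \<noteq> 0})" using assms(1) by (simp add: test_functions_def)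
    from compact_Int_closed[OF this closed_closure, of "{x. \<eta> x \<noteq> 0}"] show ?thesis
      using sub by (simp add: Int_absorb1)
  qed
  ultimately show ?thesis using assms by (auto simp: test_functions_def)
qed

lemma test_function_mult:
  assumes "\<psi> \<in> test_functions \<Omega>" "\<And>k. C_diff k \<eta>"
  shows "(\<lambda>x. \<eta> x * \<psi> x) \<in> test_functions \<Omega>"
proof (rule test_function_smaller_support[OF assms(1)])
  show "C_diff k (\<lambda>x. \<eta> x * \<psi> x)" for k
    using assms by (intro C_diff_mult) (auto simp: test_functions_def)
  show "{x. \<eta> x * \<psi> x \<noteq> 0} \<subseteq> closure {x. \<psi> x \<noteq> 0}"
    using closure_subset[of "{x. \<psi> x \<noteq> 0}"] by auto
qed

lemma test_function_partial:
  assumes "\<psi> \<in> test_functions \<Omega>" "i \<in> Basis"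
  shows "(\<lambda>x. frechet_derivative \<psi> (at x) i) \<in> test_functions \<Omega>"
proof (rule test_function_smaller_support[OF assms(1)])
  show "C_diff k (\<lambda>x. frechet_derivative \<psi> (at x) i)" for k
    using assms C_diff.simps(2)[of k \<psi>] by (auto simp: test_functions_def)
  show "{x. frechet_derivative \<psi> (at x) i \<noteq> 0} \<subseteq> closure {x. \<psi> x \<noteq> 0}"
  proof (rule subsetI, rule ccontr)
    fix x assume x: "x \<in> {x. frechet_derivative \<psi> (at x) i \<noteq> 0}" "x \<notin> closure {x. \<psi> x \<noteq> 0}"
    have "0 = \<psi> y" if "y \<in> - closure {x. \<psi> x \<noteq> 0}" for y
      using test_function_zero_outside[of y \<psi>] that by (metis ComplD)
    moreover have "((\<lambda>x. 0) has_derivative (\<lambda>h. 0)) (at x)" by simp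
    ultimately have "(\<psi> has_derivative (\<lambda>h. 0)) (at x)"
      using x(2) has_derivative_transform_within_open[of "\<lambda>x. 0" "\<lambda>h. 0" x UNIV "- closure {x. \<psi> x \<noteq> 0}" \<psi>]
      by (metis ComplI closed_closure open_Compl)
    from fun_cong[OF frechet_derivative_at[OF this], of i] x(1) show False by simp
  qed
qed

lemma test_function_measurable:
  "open \<Omega> \<Longrightarrow> \<psi> \<in> test_functions \<Omega> \<Longrightarrow> \<psi> \<in> borel_measurable (lebesgue_on \<Omega>)"
  by (intro continuous_imp_measurable_on_sets_lebesgue test_function_continuous) auto

lemma test_function_L1_loc: "open \<Omega> \<Longrightarrow> \<psi> \<in> test_functions \<Omega> \<Longrightarrow> \<psi> \<in> L1_loc \<Omega>"
  by (auto simp: L1_loc_def test_function_measurable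
      intro!: continuous_on_compact_integrable test_function_continuous)

lemma test_function_Lp:
  assumes "open \<Omega>" "\<psi> \<in> test_functions \<Omega>" "p > 0"
  shows "\<psi> \<in> Lp \<Omega> p"
proof -
  let ?K = "closure {x. \<psi> x \<noteq> 0}"
  have K: "compact ?K" "?K \<subseteq> \<Omega>" using assms(2) by (auto simp: test_functions_def)
  have "continuous_on ?K (\<lambda>x. norm (\<psi> x) powr p)"
    using assms(3) by (intro continuous_on_powr' continuous_intros test_function_continuous[OF assms(2)]) auto
  then have "integrable (lebesgue_on ?K) (\<lambda>x. norm (\<psi> x) powr p)"
    by (rule continuous_on_compact_integrable[OF K(1)])
  moreover have "integrable (lebesgue_on \<Omega>) (\<lambda>x. norm (\<psi> x) powr p) \<longleftrightarrow>
      integrable (lebesgue_on ?K) (\<lambda>x. norm (\<psi> x) powr p)"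
  proof (rule lebesgue_on_vanishing_outside(1))
    show "norm (\<psi> x) powr p = 0" if "x \<in> \<Omega> - ?K" for x
      using that test_function_zero_outside[of x \<psi>] by (simp only: Diff_iff) simp
  qed (use K assms(1) in auto)
  ultimately show ?thesis
    using assms by (simp add: Lp_def test_function_measurable)
qed

text \<open>
  The integral of \<open>\<partial>\<^sub>i(\<psi>\<eta>) = \<psi> \<partial>\<^sub>i\<eta> + \<partial>\<^sub>i\<psi> \<eta>\<close> vanishes.
\<close>

lemma test_function_has_weak_partial:
  assumes "open \<Omega>" "\<psi> \<in> test_functions \<Omega>" "i \<in> Basis"
  shows "has_weak_partial \<Omega> i \<psi> (\<lambda>x. frechet_derivative \<psi> (at x) i)"
  unfolding has_weak_partial_def
proof (intro conjI ballI)
  fix \<eta> assume \<eta>: "\<eta> \<in> test_functions \<Omega>"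
  let ?D = "\<lambda>f x. frechet_derivative f (at x) i"
  let ?f = "\<lambda>x. \<psi> x * \<eta> x"
  have f: "?f \<in> test_functions \<Omega>"
    using test_function_mult[OF \<eta>, of \<psi>] assms(2) by (simp add: test_functions_def)
  have Df: "?D ?f \<in> test_functions \<Omega>"
    using f assms(3) by (rule test_function_partial)
  have D_eq: "?D ?f = (\<lambda>x. \<psi> x * ?D \<eta> x + ?D \<psi> x * \<eta> x)"
    using test_function_differentiable[OF \<eta>] test_function_differentiable[OF assms(2)]
    by (simp add: frechet_derivative_mult_at)
  have "(LINT x|lebesgue. ?D ?f x) = 0"
  proof (rule integral_partial_derivative_eq_0[OF test_function_differentiable[OF f] assms(3)])
    show "continuous_on UNIV (?D ?f)" by (rule test_function_continuous[OF Df])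
  qed (use f Df in \<open>simp_all add: test_functions_def\<close>)
  moreover have "(LINT x|lebesgue_on UNIV. ?D ?f x) = (LINT x|lebesgue_on \<Omega>. ?D ?f x)"
  proof (rule lebesgue_on_vanishing_outside(2))
    fix x assume "x \<in> UNIV - \<Omega>"
    then show "?D ?f x = 0"
      using Df test_function_zero_outside[of x "?D ?f"] unfolding test_functions_def by blast
  qed (use assms(1) in auto)
  ultimately have "(LINT x|lebesgue_on \<Omega>. \<psi> x * ?D \<eta> x + ?D \<psi> x * \<eta> x) = 0"
    by (simp add: lebesgue_on_UNIV_eq D_eq)
  moreover have "integrable (lebesgue_on \<Omega>) (\<lambda>x. \<psi> x * ?D \<eta> x)" "integrable (lebesgue_on \<Omega>) (\<lambda>x. ?D \<psi> x * \<eta> x)"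
    using assms \<eta> by (auto intro!: L1_loc_mult_test_function_integrable test_function_L1_loc test_function_partial)
  ultimately show "(LINT x|lebesgue_on \<Omega>. \<psi> x * ?D \<eta> x) = - (LINT x|lebesgue_on \<Omega>. ?D \<psi> x * \<eta> x)"
    by (simp add: eq_neg_iff_add_eq_0)
qed (use assms in \<open>auto intro: test_function_L1_loc test_function_partial\<close>)

lemma L1_loc_lincomb:
  assumes "f \<in> L1_loc \<Omega>" "g \<in> L1_loc \<Omega>"
  shows "(\<lambda>x. c * f x + d * g x) \<in> L1_loc \<Omega>"
  using assms by (auto simp: L1_loc_def)

lemma has_weak_partial_lincomb:
  assumes "open \<Omega>" "i \<in> Basis" "has_weak_partial \<Omega> i u g" "has_weak_partial \<Omega> i v h"
  shows "has_weak_partial \<Omega> i (\<lambda>x. c * u x + d * v x) (\<lambda>x. c * g x + d * h x)"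
  unfolding has_weak_partial_def
proof (intro conjI ballI)
  have L: "u \<in> L1_loc \<Omega>" "g \<in> L1_loc \<Omega>" "v \<in> L1_loc \<Omega>" "h \<in> L1_loc \<Omega>"
    using assms by (auto simp: has_weak_partial_def)
  then show "(\<lambda>x. c * u x + d * v x) \<in> L1_loc \<Omega>" "(\<lambda>x. c * g x + d * h x) \<in> L1_loc \<Omega>"
    by (auto intro: L1_loc_lincomb)
  have split: "(LINT x|lebesgue_on \<Omega>. (c * f x + d * k x) * \<eta> x) =
      c * (LINT x|lebesgue_on \<Omega>. f x * \<eta> x) + d * (LINT x|lebesgue_on \<Omega>. k x * \<eta> x)"
    if "f \<in> L1_loc \<Omega>" "k \<in> L1_loc \<Omega>" "\<eta> \<in> test_functions \<Omega>" for f k \<eta>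
    using L1_loc_mult_test_function_integrable[OF assms(1) that(1,3)]
      L1_loc_mult_test_function_integrable[OF assms(1) that(2,3)]
    by (simp add: distrib_right mult.assoc)
  fix \<psi> assume \<psi>: "\<psi> \<in> test_functions \<Omega>"
  have "(LINT x|lebesgue_on \<Omega>. u x * frechet_derivative \<psi> (at x) i) = - (LINT x|lebesgue_on \<Omega>. g x * \<psi> x)"
    "(LINT x|lebesgue_on \<Omega>. v x * frechet_derivative \<psi> (at x) i) = - (LINT x|lebesgue_on \<Omega>. h x * \<psi> x)"
    using assms \<psi> by (auto simp: has_weak_partial_def)
  then show "(LINT x|lebesgue_on \<Omega>. (c * u x + d * v x) * frechet_derivative \<psi> (at x) i) =
      - (LINT x|lebesgue_on \<Omega>. (c * g x + d * h x) * \<psi> x)"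
    using L \<psi> assms(2) by (simp add: split test_function_partial)
qed

lemma has_weak_partial_scale:
  "open \<Omega> \<Longrightarrow> i \<in> Basis \<Longrightarrow> has_weak_partial \<Omega> i u g \<Longrightarrow>
    has_weak_partial \<Omega> i (\<lambda>x. c * u x) (\<lambda>x. c * g x)"
  using has_weak_partial_lincomb[of \<Omega> i u g u g c 0] by simp

lemma has_weak_partial_unique:
  assumes "open \<Omega>" "has_weak_partial \<Omega> i u g" "has_weak_partial \<Omega> i u h"
  shows "AE x in lebesgue_on \<Omega>. g x = h x"
proof -
  have L: "g \<in> L1_loc \<Omega>" "h \<in> L1_loc \<Omega>"
    using assms by (auto simp: has_weak_partial_def)
  have "AE x in lebesgue_on \<Omega>. 1 * g x + (- 1) * h x = 0"
  proof (rule AE_eq_0_of_test_functions[OF assms(1) L1_loc_lincomb[OF L]])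
    fix \<psi> assume \<psi>: "\<psi> \<in> test_functions \<Omega>"
    have "(LINT x|lebesgue_on \<Omega>. g x * \<psi> x) = (LINT x|lebesgue_on \<Omega>. h x * \<psi> x)"
      using assms \<psi> unfolding has_weak_partial_def by (metis neg_equal_iff_equal)
    then show "(LINT x|lebesgue_on \<Omega>. (1 * g x + (- 1) * h x) * \<psi> x) = 0"
      using L1_loc_mult_test_function_integrable[OF assms(1) L(1) \<psi>]
        L1_loc_mult_test_function_integrable[OF assms(1) L(2) \<psi>]
      by (simp add: left_diff_distrib)
  qed
  then show ?thesis by eventually_elim simp
qed

lemma has_weak_partial_weak_partial:
  "has_weak_partial \<Omega> i u g \<Longrightarrow> has_weak_partial \<Omega> i u (weak_partial \<Omega> i u)"
  unfolding weak_partial_def by (rule someI[where P = "has_weak_partial \<Omega> i u"])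

lemma weak_partial_scale:
  assumes "open \<Omega>" "i \<in> Basis" "has_weak_partial \<Omega> i u g"
  shows "AE x in lebesgue_on \<Omega>. weak_partial \<Omega> i (\<lambda>x. c * u x) x = c * weak_partial \<Omega> i u x"
proof -
  have "has_weak_partial \<Omega> i (\<lambda>x. c * u x) (\<lambda>x. c * weak_partial \<Omega> i u x)"
    using assms by (intro has_weak_partial_scale) (auto intro: has_weak_partial_weak_partial)
  then show ?thesis
    using assms(1) has_weak_partial_weak_partial has_weak_partial_unique by blast
qed

text \<open>
  An equality of functions, not merely almost everywhere: \<open>u\<close> and \<open>v\<close> have the same weak
  derivatives, so the choice operator selects the same representative for both.
\<close>

lemma weak_partial_cong_AE:
  assumes "open \<Omega>" "i \<in> Basis" "u \<in> L1_loc \<Omega>" "v \<in> L1_loc \<Omega>" "AE x in lebesgue_on \<Omega>. u x = v x"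
  shows "weak_partial \<Omega> i u = weak_partial \<Omega> i v"
proof -
  have "(LINT x|lebesgue_on \<Omega>. u x * frechet_derivative \<psi> (at x) i) =
      (LINT x|lebesgue_on \<Omega>. v x * frechet_derivative \<psi> (at x) i)"
    if "\<psi> \<in> test_functions \<Omega>" for \<psi>
  proof (rule integral_cong_AE)
    have m: "(\<lambda>x. frechet_derivative \<psi> (at x) i) \<in> borel_measurable (lebesgue_on \<Omega>)"
      by (rule test_function_measurable[OF assms(1) test_function_partial[OF that assms(2)]])
    then show "(\<lambda>x. u x * frechet_derivative \<psi> (at x) i) \<in> borel_measurable (lebesgue_on \<Omega>)"
      "(\<lambda>x. v x * frechet_derivative \<psi> (at x) i) \<in> borel_measurable (lebesgue_on \<Omega>)"
      using assms(3,4) by (auto simp: L1_loc_def intro!: borel_measurable_times)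
    show "AE x in lebesgue_on \<Omega>. u x * frechet_derivative \<psi> (at x) i = v x * frechet_derivative \<psi> (at x) i"
      using assms(5) by eventually_elim simp
  qed
  then have "has_weak_partial \<Omega> i u = has_weak_partial \<Omega> i v"
    using assms(3,4) by (auto simp: has_weak_partial_def fun_eq_iff)
  then show ?thesis by (simp add: weak_partial_def)
qed

section \<open>Sobolev spaces\<close>

lemma borel_measurable_cnj:
  "f \<in> borel_measurable M \<Longrightarrow> (\<lambda>x. cnj (f x)) \<in> borel_measurable M"
  by (rule borel_measurable_continuous_on[of cnj]) (auto intro: continuous_intros)

lemma Lp_scale:
  assumes "f \<in> Lp \<Omega> p"
  shows "(\<lambda>x. c * f x) \<in> Lp \<Omega> p"
  using assms by (auto simp: Lp_def norm_mult powr_mult)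

lemma Lp_2_mult_cnj_integrable:
  assumes "f \<in> Lp \<Omega> 2" "g \<in> Lp \<Omega> 2"
  shows "integrable (lebesgue_on \<Omega>) (\<lambda>x. f x * cnj (g x))"
proof (rule Bochner_Integration.integrable_bound)
  show "integrable (lebesgue_on \<Omega>) (\<lambda>x. norm (f x) powr 2 + norm (g x) powr 2)"
    using assms by (auto simp: Lp_def)
  show "(\<lambda>x. f x * cnj (g x)) \<in> borel_measurable (lebesgue_on \<Omega>)"
    using assms by (auto simp: Lp_def intro!: borel_measurable_times borel_measurable_cnj)
  have "norm (f x * cnj (g x)) \<le> norm (f x) powr 2 + norm (g x) powr 2" for x
  proof -
    have "norm (f x * cnj (g x)) = norm (f x) * norm (g x)" "norm (f x) powr 2 = (norm (f x))\<^sup>2"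
      "norm (g x) powr 2 = (norm (g x))\<^sup>2" "0 \<le> norm (f x) * norm (g x)"
      by (simp_all add: norm_mult)
    then show ?thesis using sum_squares_bound[of "norm (f x)" "norm (g x)"] by linarith
  qed
  then show "AE x in lebesgue_on \<Omega>. norm (f x * cnj (g x)) \<le>
      norm (norm (f x) powr 2 + norm (g x) powr 2)"
    by (intro AE_I2) (simp add: abs_of_nonneg)
qed

lemma Linf_L1_mult_cnj_integrable:
  assumes "f \<in> Linf \<Omega>" "g \<in> Lp \<Omega> 1"
  shows "integrable (lebesgue_on \<Omega>) (\<lambda>x. f x * cnj (g x))"
proof -
  obtain C where C: "AE x in lebesgue_on \<Omega>. norm (f x) \<le> C"
    using assms(1) by (auto simp: Linf_def)
  have g: "g \<in> borel_measurable (lebesgue_on \<Omega>)" "integrable (lebesgue_on \<Omega>) (\<lambda>x. norm (g x))"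
    using assms(2) by (auto simp: Lp_def)
  show ?thesis
  proof (rule Bochner_Integration.integrable_bound)
    show "integrable (lebesgue_on \<Omega>) (\<lambda>x. C * norm (g x))"
      using g by simp
    show "(\<lambda>x. f x * cnj (g x)) \<in> borel_measurable (lebesgue_on \<Omega>)"
      using assms(1) g(1) by (auto simp: Linf_def intro!: borel_measurable_times borel_measurable_cnj)
    show "AE x in lebesgue_on \<Omega>. norm (f x * cnj (g x)) \<le> norm (C * norm (g x))"
      using C by eventually_elim (auto simp: norm_mult abs_mult intro!: mult_right_mono)
  qed
qed

lemma Linf_imp_L1_loc:
  assumes "open \<Omega>" "f \<in> Linf \<Omega>"
  shows "f \<in> L1_loc \<Omega>"
proof -
  obtain C where f: "f \<in> borel_measurable (lebesgue_on \<Omega>)" and C: "AE x in lebesgue_on \<Omega>. norm (f x) \<le> C"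
    using assms(2) by (auto simp: Linf_def)
  have "integrable (lebesgue_on K) f" if K: "compact K" "K \<subseteq> \<Omega>" for K
  proof -
    have lm: "K \<in> lmeasurable" using K(1) by (rule lmeasurable_compact)
    then interpret finite_measure "lebesgue_on K" by (rule finite_measure_lebesgue_on)
    show ?thesis
    proof (rule integrable_const_bound[of _ C])
      show "f \<in> borel_measurable (lebesgue_on K)"
        using f K(2) by (rule measurable_restrict_mono)
      have "AE x in lebesgue. x \<in> \<Omega> \<longrightarrow> norm (f x) \<le> C"
        using C assms(1) by (simp add: AE_restrict_space_iff)
      then have "AE x in lebesgue. x \<in> K \<longrightarrow> norm (f x) \<le> C"
        by eventually_elim (use K(2) in blast)
      then show "AE x in lebesgue_on K. norm (f x) \<le> C"
        using lm by (simp add: AE_restrict_space_iff fmeasurableD)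
    qed
  qed
  with f show ?thesis by (auto simp: L1_loc_def)
qed

lemma Lp_2_imp_Lp_1:
  assumes "open \<Omega>" "emeasure lebesgue \<Omega> < \<infinity>" "f \<in> Lp \<Omega> 2"
  shows "f \<in> Lp \<Omega> 1"
proof -
  have "\<Omega> \<in> lmeasurable" using assms by (intro fmeasurableI) (auto simp: )
  then interpret finite_measure "lebesgue_on \<Omega>" by (rule finite_measure_lebesgue_on)
  have "integrable (lebesgue_on \<Omega>) (\<lambda>x. norm (f x) powr 1)"
  proof (rule Bochner_Integration.integrable_bound)
    show "integrable (lebesgue_on \<Omega>) (\<lambda>x. 1 + norm (f x) powr 2)"
      using assms(3) by (auto simp: Lp_def)
    have "norm (f x) powr 1 \<le> 1 + norm (f x) powr 2" for x
    proof -
      have "norm (f x) powr 1 = norm (f x)" "norm (f x) powr 2 = (norm (f x))\<^sup>2" "0 \<le> norm (f x)"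
        by simp_all
      then show ?thesis using sum_squares_bound[of "norm (f x)" 1] by (simp only: power_one mult_1_right)
    qed
    then show "AE x in lebesgue_on \<Omega>. norm (norm (f x) powr 1) \<le> norm (1 + norm (f x) powr 2)"
      by (intro AE_I2) (simp add: abs_of_nonneg)
  qed (use assms(3) in \<open>auto simp: Lp_def\<close>)
  then show ?thesis using assms(3) by (simp add: Lp_def)
qed

lemma H1_has_weak_partial:
  "u \<in> H1 \<Omega> \<Longrightarrow> i \<in> Basis \<Longrightarrow> has_weak_partial \<Omega> i u (weak_partial \<Omega> i u)"
  unfolding H1_def using has_weak_partial_weak_partial by blast

lemma H1_weak_partial_Lp:
  assumes "open \<Omega>" "u \<in> H1 \<Omega>" "i \<in> Basis"
  shows "weak_partial \<Omega> i u \<in> Lp \<Omega> 2"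
proof -
  obtain g where g: "g \<in> Lp \<Omega> 2" "has_weak_partial \<Omega> i u g"
    using assms by (auto simp: H1_def)
  let ?w = "weak_partial \<Omega> i u"
  have w: "has_weak_partial \<Omega> i u ?w"
    using assms(2,3) by (rule H1_has_weak_partial)
  then have "AE x in lebesgue_on \<Omega>. g x = ?w x"
    using g assms(1) has_weak_partial_unique by blast
  moreover have m: "?w \<in> borel_measurable (lebesgue_on \<Omega>)"
    using w by (auto simp: has_weak_partial_def L1_loc_def)
  ultimately have "integrable (lebesgue_on \<Omega>) (\<lambda>x. norm (?w x) powr 2)"
    using g(1) by (subst integrable_cong_AE[where g = "\<lambda>x. norm (g x) powr 2"]) (auto simp: Lp_def)
  with m show ?thesis by (simp add: Lp_def)
qed

lemma H1_scale:
  assumes "open \<Omega>" "u \<in> H1 \<Omega>"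
  shows "(\<lambda>x. c * u x) \<in> H1 \<Omega>"
  unfolding H1_def
proof (intro CollectI conjI ballI)
  show "(\<lambda>x. c * u x) \<in> Lp \<Omega> 2"
    using assms by (auto simp: H1_def intro: Lp_scale)
  fix i :: 'a assume i: "i \<in> Basis"
  have "has_weak_partial \<Omega> i (\<lambda>x. c * u x) (\<lambda>x. c * weak_partial \<Omega> i u x)"
    by (rule has_weak_partial_scale[OF assms(1) i H1_has_weak_partial[OF assms(2) i]])
  then show "\<exists>g\<in>Lp \<Omega> 2. has_weak_partial \<Omega> i (\<lambda>x. c * u x) g"
    using Lp_scale[OF H1_weak_partial_Lp[OF assms i]] by blast
qed

lemma test_function_H1: "open \<Omega> \<Longrightarrow> \<psi> \<in> test_functions \<Omega> \<Longrightarrow> \<psi> \<in> H1 \<Omega>"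
  unfolding H1_def
  using test_function_has_weak_partial test_function_Lp[of \<Omega> _ 2] test_function_partial by fastforce

text \<open>
  Stated for the existence of weak derivatives, which is what the differences \<open>u - \<psi>\<^sub>n\<close> in the
  definition of \<open>H\<^sup>1\<^sub>0(\<Omega>)\<close> inherit from \<open>u\<close> and \<open>\<psi>\<^sub>n\<close> by linearity.
\<close>

lemma H1_norm_scale:
  assumes "open \<Omega>" "\<And>i. i \<in> Basis \<Longrightarrow> \<exists>g. has_weak_partial \<Omega> i u g"
  shows "H1_norm \<Omega> (\<lambda>x. c * u x) = norm c * H1_norm \<Omega> u"
proof -
  have br: "bracket \<Omega> (\<lambda>x. c * f x) (\<lambda>x. c * f x) = (norm c)\<^sup>2 * bracket \<Omega> f f" for f
  proof -
    have "c * f x * cnj (c * f x) = complex_of_real ((norm c)\<^sup>2) * (f x * cnj (f x))" for x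
      by (simp only: complex_norm_square) simp
    then show ?thesis
      unfolding bracket_def by (simp only: integral_mult_right_zero) simp
  qed
  have "bracket \<Omega> (weak_partial \<Omega> i (\<lambda>x. c * u x)) (weak_partial \<Omega> i (\<lambda>x. c * u x)) =
      (norm c)\<^sup>2 * bracket \<Omega> (weak_partial \<Omega> i u) (weak_partial \<Omega> i u)" if i: "i \<in> Basis" for i
  proof -
    obtain g where g: "has_weak_partial \<Omega> i u g" using assms(2)[OF i] by blast
    have m: "weak_partial \<Omega> i u \<in> borel_measurable (lebesgue_on \<Omega>)"
      "weak_partial \<Omega> i (\<lambda>x. c * u x) \<in> borel_measurable (lebesgue_on \<Omega>)"
      using has_weak_partial_weak_partial[OF g]
        has_weak_partial_weak_partial[OF has_weak_partial_scale[OF assms(1) i g, of c]]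
      by (auto simp: has_weak_partial_def L1_loc_def)
    have "bracket \<Omega> (weak_partial \<Omega> i (\<lambda>x. c * u x)) (weak_partial \<Omega> i (\<lambda>x. c * u x)) =
        bracket \<Omega> (\<lambda>x. c * weak_partial \<Omega> i u x) (\<lambda>x. c * weak_partial \<Omega> i u x)"
      unfolding bracket_def using weak_partial_scale[OF assms(1) i g, of c] m
      by (intro arg_cong[where f = Re] integral_cong_AE) (auto intro!: borel_measurable_times borel_measurable_cnj)
    then show ?thesis by (simp add: br)
  qed
  then have "grad_bracket \<Omega> (\<lambda>x. c * u x) (\<lambda>x. c * u x) = (norm c)\<^sup>2 * grad_bracket \<Omega> u u"
    unfolding grad_bracket_def by (simp add: sum_distrib_left)
  then show ?thesis
    by (simp add: H1_norm_def br distrib_left[symmetric] real_sqrt_mult)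
qed

lemma test_function_scale:
  "\<psi> \<in> test_functions \<Omega> \<Longrightarrow> (\<lambda>x. c * \<psi> x) \<in> test_functions \<Omega>"
  by (intro test_function_mult C_diff_const)

lemma H10_scale:
  assumes "open \<Omega>" "u \<in> H10 \<Omega>"
  shows "(\<lambda>x. c * u x) \<in> H10 \<Omega>"
proof -
  obtain \<psi> where u: "u \<in> H1 \<Omega>" and \<psi>: "\<And>n. \<psi> n \<in> test_functions \<Omega>"
    and lim: "(\<lambda>n. H1_norm \<Omega> (\<lambda>x. u x - \<psi> n x)) \<longlonglongrightarrow> 0"
    using assms(2) by (auto simp: H10_def)
  have "\<exists>g. has_weak_partial \<Omega> i (\<lambda>x. u x - \<psi> n x) g" if "i \<in> Basis" for i n
    using has_weak_partial_lincomb[OF assms(1) that H1_has_weak_partial[OF u that]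
        H1_has_weak_partial[OF test_function_H1[OF assms(1) \<psi>] that], of 1 "-1"] by auto
  then have "H1_norm \<Omega> (\<lambda>x. c * (u x - \<psi> n x)) = norm c * H1_norm \<Omega> (\<lambda>x. u x - \<psi> n x)" for n
    using assms(1) by (intro H1_norm_scale) auto
  then have "H1_norm \<Omega> (\<lambda>x. c * u x - c * \<psi> n x) = norm c * H1_norm \<Omega> (\<lambda>x. u x - \<psi> n x)" for n
    by (simp add: right_diff_distrib)
  then have "(\<lambda>n. H1_norm \<Omega> (\<lambda>x. c * u x - c * \<psi> n x)) \<longlonglongrightarrow> 0"
    using tendsto_mult_right_zero[OF lim, of "norm c"] by simp
  then show ?thesis
    using H1_scale[OF assms(1) u] test_function_scale[OF \<psi>]
    unfolding H10_def by (auto intro!: exI[of _ "\<lambda>n x. c * \<psi> n x"])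
qed

lemma test_function_H10:
  assumes "open \<Omega>" "\<psi> \<in> test_functions \<Omega>"
  shows "\<psi> \<in> H10 \<Omega>"
proof -
  have "H1_norm \<Omega> (\<lambda>x. 0 * \<psi> x) = norm (0::complex) * H1_norm \<Omega> \<psi>"
    using assms by (intro H1_norm_scale) (auto intro: test_function_has_weak_partial)
  then have "H1_norm \<Omega> (\<lambda>x. \<psi> x - \<psi> x) = 0" by simp
  then show ?thesis
    using assms test_function_H1 unfolding H10_def by (auto intro!: exI[of _ "\<lambda>n. \<psi>"])
qed


section \<open>Monotonicity of the saturated section\<close>

text \<open>
  The equality case of \<open>Re w \<le> norm w\<close>. It turns information on real parts, which is all that
  monotonicity provides, into information on complex numbers.
\<close>

lemma complex_eq_of_Re_eq_bound:
  assumes "norm w \<le> r" "Re w = r"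
  shows "w = complex_of_real r"
proof -
  have "(Re w)\<^sup>2 + (Im w)\<^sup>2 \<le> r\<^sup>2"
    using assms(1) power_mono[OF assms(1) norm_ge_zero, of 2] by (simp add: cmod_power2)
  then have "Im w = 0" using assms(2) by simp
  then show ?thesis using assms(2) by (simp add: complex_eq_iff)
qed

text \<open>
  As \<open>U\<^sub>j cnj z\<^sub>j = |z\<^sub>j|\<close>, the product is
  \<open>(|z\<^sub>1| - U\<^sub>2 cnj z\<^sub>1) + (|z\<^sub>2| - U\<^sub>1 cnj z\<^sub>2)\<close>, and both terms have nonnegative real part since
  \<open>|U\<^sub>j| \<le> 1\<close>. If the sum has real part 0, both terms do, and then they vanish.
\<close>

lemma saturation_monotone:
  fixes z1 z2 U1 U2 :: complex
  assumes n: "norm U1 \<le> 1" "norm U2 \<le> 1"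
    and U1: "z1 \<noteq> 0 \<longrightarrow> U1 = z1 / complex_of_real (norm z1)"
    and U2: "z2 \<noteq> 0 \<longrightarrow> U2 = z2 / complex_of_real (norm z2)"
  shows "0 \<le> Re ((U1 - U2) * cnj (z1 - z2))"
    and "Re ((U1 - U2) * cnj (z1 - z2)) = 0 \<Longrightarrow> (U1 - U2) * cnj (z1 - z2) = 0"
proof -
  have diag: "U * cnj z = complex_of_real (norm z)" if "z \<noteq> 0 \<longrightarrow> U = z / complex_of_real (norm z)" for U z
    using that by (cases "z = 0") (auto simp: complex_norm_square[symmetric] power2_eq_square)
  have off: "norm (U * cnj z) \<le> norm z" if "norm U \<le> 1" for U z :: complex
    using mult_right_mono[OF that norm_ge_zero[of z]] by (simp add: norm_mult)
  have expand: "(U1 - U2) * cnj (z1 - z2) =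
      complex_of_real (norm z1) + complex_of_real (norm z2) - U1 * cnj z2 - U2 * cnj z1"
    using diag[OF U1] diag[OF U2] by (simp add: algebra_simps)
  have le: "Re (U1 * cnj z2) \<le> norm z2" "Re (U2 * cnj z1) \<le> norm z1"
    using off[OF n(1)] off[OF n(2)] complex_Re_le_cmod order_trans by blast+
  then show "0 \<le> Re ((U1 - U2) * cnj (z1 - z2))"
    unfolding expand by (simp only: minus_complex.simps plus_complex.simps Re_complex_of_real)
  assume "Re ((U1 - U2) * cnj (z1 - z2)) = 0"
  then have "Re (U1 * cnj z2) = norm z2" "Re (U2 * cnj z1) = norm z1"
    using le unfolding expand by (simp_all only: minus_complex.simps plus_complex.simps Re_complex_of_real)
  then have "U1 * cnj z2 = complex_of_real (norm z2)" "U2 * cnj z1 = complex_of_real (norm z1)"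
    using off[OF n(1), of z2] off[OF n(2), of z1] complex_eq_of_Re_eq_bound by blast+
  then show "(U1 - U2) * cnj (z1 - z2) = 0"
    unfolding expand by simp
qed

section \<open>The energy identity\<close>

text \<open>
  The complex form of which \<open>bracket\<close> is the real part. It is sesquilinear, whereas \<open>bracket\<close> is
  only real-bilinear.
\<close>

definition pairing :: "'a::euclidean_space set \<Rightarrow> ('a \<Rightarrow> complex) \<Rightarrow> ('a \<Rightarrow> complex) \<Rightarrow> complex" where
  "pairing \<Omega> f g = (LINT x|lebesgue_on \<Omega>. f x * cnj (g x))"

lemma bracket_scale_right: "bracket \<Omega> f (\<lambda>x. c * g x) = Re (cnj c * pairing \<Omega> f g)"
proof -
  have "f x * cnj (c * g x) = cnj c * (f x * cnj (g x))" for x by simp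
  then show ?thesis by (simp only: bracket_def pairing_def integral_mult_right_zero)
qed

lemma pairing_scale_left: "pairing \<Omega> (\<lambda>x. c * f x) g = c * pairing \<Omega> f g"
  by (simp add: pairing_def mult.assoc)

lemma eq_if_Re_cnj_mult_eq: 
  assumes "\<And>c. Re (cnj c * z) = Re (cnj c * w)"
  shows "z = w"
  using assms[of 1] assms[of \<i>] by (simp add: complex_eq_iff)

lemma pairing_diff_diff:
  assumes "integrable (lebesgue_on \<Omega>) (\<lambda>x. f1 x * cnj (g1 x))" "integrable (lebesgue_on \<Omega>) (\<lambda>x. f1 x * cnj (g2 x))"
    "integrable (lebesgue_on \<Omega>) (\<lambda>x. f2 x * cnj (g1 x))" "integrable (lebesgue_on \<Omega>) (\<lambda>x. f2 x * cnj (g2 x))"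
  shows "integrable (lebesgue_on \<Omega>) (\<lambda>x. (f1 x - f2 x) * cnj (g1 x - g2 x))"
    and "(LINT x|lebesgue_on \<Omega>. (f1 x - f2 x) * cnj (g1 x - g2 x)) =
      (pairing \<Omega> f1 g1 - pairing \<Omega> f2 g1) - (pairing \<Omega> f1 g2 - pairing \<Omega> f2 g2)"
proof -
  have "(f1 x - f2 x) * cnj (g1 x - g2 x) =
      (f1 x * cnj (g1 x) - f2 x * cnj (g1 x)) - (f1 x * cnj (g2 x) - f2 x * cnj (g2 x))" for x
    by (simp add: algebra_simps)
  then show "integrable (lebesgue_on \<Omega>) (\<lambda>x. (f1 x - f2 x) * cnj (g1 x - g2 x))"
    "(LINT x|lebesgue_on \<Omega>. (f1 x - f2 x) * cnj (g1 x - g2 x)) =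
      (pairing \<Omega> f1 g1 - pairing \<Omega> f2 g1) - (pairing \<Omega> f1 g2 - pairing \<Omega> f2 g2)"
    using assms by (simp_all add: pairing_def del: complex_cnj_diff)
qed

text \<open>
  The common features of the Dirichlet and the Neumann test space on which uniqueness rests.
  Inclusion in \<open>L\<^sup>1(\<Omega>)\<close> makes \<open>U cnj v\<close> integrable; the complex multiples allow the choices of
  multiplier in the energy argument.
\<close>

definition admissible_space :: "'a::euclidean_space set \<Rightarrow> ('a \<Rightarrow> complex) set \<Rightarrow> bool" where
  "admissible_space \<Omega> X \<longleftrightarrow> X \<subseteq> H1 \<Omega> \<inter> Lp \<Omega> 1 \<and> test_functions \<Omega> \<subseteq> X \<and>
     (\<forall>c. \<forall>u\<in>X. (\<lambda>x. c * u x) \<in> X)"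

definition sesquilinear_form ::
    "'a::euclidean_space set \<Rightarrow> complex \<Rightarrow> complex \<Rightarrow> ('a \<Rightarrow> complex) \<Rightarrow>
     ('a \<Rightarrow> complex) \<Rightarrow> ('a \<Rightarrow> complex) \<Rightarrow> ('a \<Rightarrow> complex) \<Rightarrow> complex" where
  "sesquilinear_form \<Omega> a b \<phi> u U v =
     (\<Sum>i\<in>Basis. pairing \<Omega> (weak_partial \<Omega> i u) (weak_partial \<Omega> i v)) + a * pairing \<Omega> U v
      + b * pairing \<Omega> u v + pairing \<Omega> (\<lambda>x. \<phi> x * u x) v"

lemma grad_bracket_scale_right:
  assumes "open \<Omega>" "u \<in> H1 \<Omega>" "v \<in> H1 \<Omega>"
  shows "grad_bracket \<Omega> u (\<lambda>x. c * v x) =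
    Re (cnj c * (\<Sum>i\<in>Basis. pairing \<Omega> (weak_partial \<Omega> i u) (weak_partial \<Omega> i v)))"
proof -
  have "bracket \<Omega> (weak_partial \<Omega> i u) (weak_partial \<Omega> i (\<lambda>x. c * v x)) =
      Re (cnj c * pairing \<Omega> (weak_partial \<Omega> i u) (weak_partial \<Omega> i v))" if i: "i \<in> Basis" for i
  proof -
    have m: "weak_partial \<Omega> i w \<in> borel_measurable (lebesgue_on \<Omega>)" if "w \<in> H1 \<Omega>" for w
      using H1_has_weak_partial[OF that i] by (auto simp: has_weak_partial_def L1_loc_def)
    have "bracket \<Omega> (weak_partial \<Omega> i u) (weak_partial \<Omega> i (\<lambda>x. c * v x)) =
        bracket \<Omega> (weak_partial \<Omega> i u) (\<lambda>x. c * weak_partial \<Omega> i v x)"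
      unfolding bracket_def
      using weak_partial_scale[OF assms(1) i H1_has_weak_partial[OF assms(3) i], of c]
        m[OF assms(2)] m[OF assms(3)] m[OF H1_scale[OF assms(1,3), of c]]
      by (intro arg_cong[where f = Re] integral_cong_AE)
        (auto intro!: borel_measurable_times borel_measurable_cnj)
    then show ?thesis by (simp only: bracket_scale_right)
  qed
  then show ?thesis
    unfolding grad_bracket_def by (simp add: sum_distrib_left)
qed

text \<open>
  The real parts of all the rotated values \<open>cnj c * A(u, v)\<close> are prescribed by \<open>F\<close>, hence so is the complex
  number \<open>A(u, v)\<close>.
\<close>

lemma weak_solution_sesquilinear:
  assumes "open \<Omega>" "admissible_space \<Omega> X" "weak_solution_in X \<Omega> a b \<phi> F u U" "v \<in> X"
  shows "Re (cnj c * sesquilinear_form \<Omega> a b \<phi> u U v) = F (\<lambda>x. c * v x)"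
proof -
  have "u \<in> H1 \<Omega>" "v \<in> H1 \<Omega>" "(\<lambda>x. c * v x) \<in> X"
    using assms by (auto simp: admissible_space_def weak_solution_in_def)
  moreover from this have "F (\<lambda>x. c * v x) = grad_bracket \<Omega> u (\<lambda>x. c * v x)
      + bracket \<Omega> (\<lambda>x. a * U x) (\<lambda>x. c * v x) + bracket \<Omega> (\<lambda>x. b * u x) (\<lambda>x. c * v x)
      + bracket \<Omega> (\<lambda>x. \<phi> x * u x) (\<lambda>x. c * v x)"
    using assms(3) by (simp add: weak_solution_in_def)
  ultimately show ?thesis
    using assms(1) unfolding sesquilinear_form_def
    by (simp only: grad_bracket_scale_right bracket_scale_right pairing_scale_left distrib_left plus_complex.simps)
qed

lemma weak_solutions_same_form:
  assumes "open \<Omega>" "admissible_space \<Omega> X"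
    and "weak_solution_in X \<Omega> a b \<phi> F u1 U1" "weak_solution_in X \<Omega> a b \<phi> F u2 U2" "v \<in> X"
  shows "sesquilinear_form \<Omega> a b \<phi> u1 U1 v = sesquilinear_form \<Omega> a b \<phi> u2 U2 v"
  using weak_solution_sesquilinear[OF assms(1,2) _ assms(5)] assms(3,4)
  by (intro eq_if_Re_cnj_mult_eq) simp

text \<open>
  The equations for \<open>u\<^sub>1\<close> and \<open>u\<^sub>2\<close>, tested with \<open>u\<^sub>1\<close> and with \<open>u\<^sub>2\<close>, are combined with alternating
  signs: the pairing of two differences is the alternating sum of four pairings, and the values of
  \<open>F\<close> cancel for each test function.
\<close>

lemma energy_identity:
  assumes "open \<Omega>" "admissible_space \<Omega> X"
    and s1: "weak_solution_in X \<Omega> a b \<phi> F u1 U1" and s2: "weak_solution_in X \<Omega> a b \<phi> F u2 U2"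
  defines "q \<equiv> \<lambda>x. (b + \<phi> x) * complex_of_real ((norm (u1 x - u2 x))\<^sup>2)"
  obtains G where "G \<ge> 0"
    "complex_of_real G + a * (LINT x|lebesgue_on \<Omega>. (U1 x - U2 x) * cnj (u1 x - u2 x))
      + (LINT x|lebesgue_on \<Omega>. q x) = 0"
    "integrable (lebesgue_on \<Omega>) (\<lambda>x. (U1 x - U2 x) * cnj (u1 x - u2 x))"
    "integrable (lebesgue_on \<Omega>) q"
proof -
  let ?L = "lebesgue_on \<Omega>" and ?w1 = "\<lambda>i. weak_partial \<Omega> i u1" and ?w2 = "\<lambda>i. weak_partial \<Omega> i u2"
  have X: "u1 \<in> X" "u2 \<in> X" using s1 s2 by (auto simp: weak_solution_in_def)
  have H: "u1 \<in> H1 \<Omega>" "u2 \<in> H1 \<Omega>" and L1: "u1 \<in> Lp \<Omega> 1" "u2 \<in> Lp \<Omega> 1"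
    using X assms(2) by (auto simp: admissible_space_def)
  then have L2: "u1 \<in> Lp \<Omega> 2" "u2 \<in> Lp \<Omega> 2" by (auto simp: H1_def)
  have pL2: "(\<lambda>x. \<phi> x * u1 x) \<in> Lp \<Omega> 2" "(\<lambda>x. \<phi> x * u2 x) \<in> Lp \<Omega> 2"
    using s1 s2 by (auto simp: weak_solution_in_def)
  have Li: "U1 \<in> Linf \<Omega>" "U2 \<in> Linf \<Omega>"
    using s1 s2 by (auto simp: weak_solution_in_def saturated_section_def)
  have grad: "(LINT x|?L. (?w1 i x - ?w2 i x) * cnj (?w1 i x - ?w2 i x)) =
      (pairing \<Omega> (?w1 i) (?w1 i) - pairing \<Omega> (?w2 i) (?w1 i))
      - (pairing \<Omega> (?w1 i) (?w2 i) - pairing \<Omega> (?w2 i) (?w2 i))" if "i \<in> Basis" for i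
    by (intro pairing_diff_diff(2) Lp_2_mult_cnj_integrable H1_weak_partial_Lp assms(1) H that)
  have grad_sum: "(\<Sum>i\<in>Basis. LINT x|?L. (?w1 i x - ?w2 i x) * cnj (?w1 i x - ?w2 i x)) =
      ((\<Sum>i\<in>Basis. pairing \<Omega> (?w1 i) (?w1 i)) - (\<Sum>i\<in>Basis. pairing \<Omega> (?w2 i) (?w1 i)))
      - ((\<Sum>i\<in>Basis. pairing \<Omega> (?w1 i) (?w2 i)) - (\<Sum>i\<in>Basis. pairing \<Omega> (?w2 i) (?w2 i)))"
    unfolding sum_subtractf[symmetric] by (intro sum.cong refl grad)
  note sat = pairing_diff_diff[OF Linf_L1_mult_cnj_integrable[OF Li(1) L1(1)]
      Linf_L1_mult_cnj_integrable[OF Li(1) L1(2)] Linf_L1_mult_cnj_integrable[OF Li(2) L1(1)]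
      Linf_L1_mult_cnj_integrable[OF Li(2) L1(2)]]
  note lin = pairing_diff_diff[OF Lp_2_mult_cnj_integrable[OF L2(1) L2(1)]
      Lp_2_mult_cnj_integrable[OF L2(1) L2(2)] Lp_2_mult_cnj_integrable[OF L2(2) L2(1)]
      Lp_2_mult_cnj_integrable[OF L2(2) L2(2)]]
  note pot = pairing_diff_diff[OF Lp_2_mult_cnj_integrable[OF pL2(1) L2(1)]
      Lp_2_mult_cnj_integrable[OF pL2(1) L2(2)] Lp_2_mult_cnj_integrable[OF pL2(2) L2(1)]
      Lp_2_mult_cnj_integrable[OF pL2(2) L2(2)]]
  have q: "q = (\<lambda>x. b * ((u1 x - u2 x) * cnj (u1 x - u2 x))
      + (\<phi> x * u1 x - \<phi> x * u2 x) * cnj (u1 x - u2 x))"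
    by (simp only: q_def complex_norm_square) (simp add: algebra_simps)
  have q_int: "integrable ?L q"
    unfolding q by (intro Bochner_Integration.integrable_add integrable_mult_right lin(1) pot(1))
  have q_eq: "(LINT x|?L. q x) = b * (LINT x|?L. (u1 x - u2 x) * cnj (u1 x - u2 x))
      + (LINT x|?L. (\<phi> x * u1 x - \<phi> x * u2 x) * cnj (u1 x - u2 x))"
    unfolding q by (subst Bochner_Integration.integral_add[OF integrable_mult_right[OF lin(1)] pot(1)])
      (simp only: integral_mult_right_zero)
  define G where "G = (\<Sum>i\<in>Basis. LINT x|?L. (norm (?w1 i x - ?w2 i x))\<^sup>2)"
  have "G \<ge> 0" unfolding G_def by (intro sum_nonneg Bochner_Integration.integral_nonneg) simp
  have G: "complex_of_real G = (\<Sum>i\<in>Basis. LINT x|?L. (?w1 i x - ?w2 i x) * cnj (?w1 i x - ?w2 i x))"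
    unfolding G_def of_real_sum
    by (simp only: complex_norm_square[symmetric] integral_complex_of_real)
  let ?A = "sesquilinear_form \<Omega> a b \<phi>"
  have "complex_of_real G + a * (LINT x|?L. (U1 x - U2 x) * cnj (u1 x - u2 x)) + (LINT x|?L. q x)
      = (?A u1 U1 u1 - ?A u2 U2 u1) - (?A u1 U1 u2 - ?A u2 U2 u2)"
    unfolding G q_eq sat(2) lin(2) pot(2) sesquilinear_form_def
    by (simp only: grad_sum) (simp add: algebra_simps)
  also have "\<dots> = 0"
    using weak_solutions_same_form[OF assms(1,2) s1 s2] X by simp
  finally show ?thesis
    using \<open>G \<ge> 0\<close> sat(1) q_int that by blast
qed

section \<open>Uniqueness\<close>

lemma Re_mult_of_real: "Re (z * complex_of_real r) = Re z * r"
  by simp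

text \<open>
  The integral of \<open>Re (cnj c * w) |u|\<^sup>2\<close> is both nonnegative and nonpositive, and the weight is
  positive.
\<close>

lemma AE_eq_0_of_coercive:
  assumes "integrable M (\<lambda>x. w x * complex_of_real ((norm (u x))\<^sup>2))"
    and "AE x in M. Re (cnj c * w x) > 0"
    and "Re (cnj c * (LINT x|M. w x * complex_of_real ((norm (u x))\<^sup>2))) \<le> 0"
  shows "AE x in M. u x = (0::complex)"
proof -
  let ?f = "\<lambda>x. Re (cnj c * (w x * complex_of_real ((norm (u x))\<^sup>2)))"
  have f: "?f x = Re (cnj c * w x) * (norm (u x))\<^sup>2" for x
    by (simp only: mult.assoc[symmetric] Re_mult_of_real)
  have int: "integrable M (\<lambda>x. cnj c * (w x * complex_of_real ((norm (u x))\<^sup>2)))"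
    using assms(1) by (rule integrable_mult_right)
  have nn: "AE x in M. 0 \<le> ?f x"
    using assms(2) unfolding f by eventually_elim simp
  have "(LINT x|M. ?f x) = Re (cnj c * (LINT x|M. w x * complex_of_real ((norm (u x))\<^sup>2)))"
    by (simp only: integral_Re[OF int] integral_mult_right_zero)
  then have "(LINT x|M. ?f x) = 0"
    using assms(3) Bochner_Integration.integral_nonneg_AE[OF nn] by linarith
  then have "AE x in M. ?f x = 0"
    using integral_nonneg_eq_0_iff_AE[OF integrable_Re[OF int] nn] by blast
  with assms(2) show ?thesis
    unfolding f by eventually_elim simp
qed

text \<open>
  The multipliers \<open>a\<close>, \<open>1\<close>, \<open>\<i>\<close> and \<open>- \<i>\<close> turn the four alternatives into one: the weight
  \<open>Re (cnj c * (b + \<phi>))\<close> is positive and its integral against \<open>|u|\<^sup>2\<close> is at most 0.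
\<close>

lemma weak_solutions_difference_eq_0:
  assumes "open \<Omega>" "admissible_space \<Omega> X" "a \<noteq> 0" "Re a \<ge> 0"
    and nonneg: "AE x in lebesgue_on \<Omega>. Re (cnj a * (b + \<phi> x)) \<ge> 0"
    and alt: "(AE x in lebesgue_on \<Omega>. Re (cnj a * (b + \<phi> x)) > 0) \<or>
       (AE x in lebesgue_on \<Omega>. Re (b + \<phi> x) > 0) \<or>
       (AE x in lebesgue_on \<Omega>. Im (b + \<phi> x) > 0) \<or>
       (AE x in lebesgue_on \<Omega>. Im (b + \<phi> x) < 0)"
    and s1: "weak_solution_in X \<Omega> a b \<phi> F u1 U1" and s2: "weak_solution_in X \<Omega> a b \<phi> F u2 U2"
  shows "AE x in lebesgue_on \<Omega>. u1 x - u2 x = 0"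
proof -
  let ?L = "lebesgue_on \<Omega>" and ?p = "\<lambda>x. (U1 x - U2 x) * cnj (u1 x - u2 x)"
  let ?q = "\<lambda>x. (b + \<phi> x) * complex_of_real ((norm (u1 x - u2 x))\<^sup>2)"
  obtain G where G: "G \<ge> 0" and eq: "complex_of_real G + a * (LINT x|?L. ?p x) + (LINT x|?L. ?q x) = 0"
    and p: "integrable ?L ?p" and q: "integrable ?L ?q"
    by (rule energy_identity[OF assms(1,2) s1 s2])
  define P where "P = (LINT x|?L. ?p x)"
  define Q where "Q = (LINT x|?L. ?q x)"
  have eq: "complex_of_real G + a * P + Q = 0" using eq by (simp only: P_def Q_def)
  have sat: "AE x in ?L. 0 \<le> Re (?p x) \<and> (Re (?p x) = 0 \<longrightarrow> ?p x = 0)"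
  proof -
    have "AE x in ?L. norm (U1 x) \<le> 1" "AE x in ?L. norm (U2 x) \<le> 1"
      "AE x in ?L. u1 x \<noteq> 0 \<longrightarrow> U1 x = u1 x / complex_of_real (norm (u1 x))"
      "AE x in ?L. u2 x \<noteq> 0 \<longrightarrow> U2 x = u2 x / complex_of_real (norm (u2 x))"
      using s1 s2 by (auto simp: weak_solution_in_def saturated_section_def)
    then show ?thesis by eventually_elim (use saturation_monotone in blast)
  qed
  then have p_nn: "AE x in ?L. 0 \<le> Re (?p x)" by eventually_elim simp
  have Re_P: "Re P = (LINT x|?L. Re (?p x))" unfolding P_def by (rule integral_Re[OF p, symmetric])
  then have "Re P \<ge> 0" using Bochner_Integration.integral_nonneg_AE[OF p_nn] by simp
  have Q_nn: "Re (cnj a * Q) \<ge> 0"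
  proof -
    have "Re (cnj a * Q) = (LINT x|?L. Re (cnj a * ?q x))"
      unfolding Q_def integral_mult_right_zero[symmetric]
      by (rule integral_Re[OF integrable_mult_right[OF q], symmetric])
    moreover have "AE x in ?L. 0 \<le> Re (cnj a * ?q x)"
      using nonneg by eventually_elim (simp only: mult.assoc[symmetric] Re_mult_of_real, simp)
    ultimately show ?thesis using Bochner_Integration.integral_nonneg_AE by simp
  qed
  \<comment> \<open>Multiplication by \<open>cnj a\<close> turns \<open>a P\<close> into \<open>|a|\<^sup>2 P\<close>, whose real part has a sign.\<close>
  have split: "Re a * G + (norm a)\<^sup>2 * Re P + Re (cnj a * Q) = 0"
  proof -
    have "cnj a * complex_of_real G + complex_of_real ((norm a)\<^sup>2) * P + cnj a * Q =
        cnj a * (complex_of_real G + a * P + Q)"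
      by (simp only: complex_norm_square) (simp add: algebra_simps)
    then have "Re (cnj a * complex_of_real G + complex_of_real ((norm a)\<^sup>2) * P + cnj a * Q) = 0"
      by (simp only: eq) simp
    then show ?thesis by simp
  qed
  moreover have "0 \<le> Re a * G" "0 \<le> (norm a)\<^sup>2 * Re P"
    using \<open>Re a \<ge> 0\<close> G \<open>Re P \<ge> 0\<close> by simp_all
  ultimately have "(norm a)\<^sup>2 * Re P = 0" "Re (cnj a * Q) = 0"
    using Q_nn by linarith+
  then have "Re P = 0" using \<open>a \<noteq> 0\<close> by simp
  then have "AE x in ?L. Re (?p x) = 0"
    using integral_nonneg_eq_0_iff_AE[OF integrable_Re[OF p] p_nn] Re_P by simp
  with sat have "AE x in ?L. ?p x = 0" by eventually_elim blast
  then have "P = 0" unfolding P_def by (rule integral_eq_zero_AE)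
  with eq have "Q = - complex_of_real G" by (simp add: eq_neg_iff_add_eq_0 add.commute)
  then have "Re Q \<le> 0" "Im Q = 0" using G by simp_all
  have "\<exists>c. (AE x in ?L. Re (cnj c * (b + \<phi> x)) > 0) \<and> Re (cnj c * Q) \<le> 0"
    using alt
  proof (elim disjE)
    assume "AE x in ?L. Re (cnj a * (b + \<phi> x)) > 0"
    then show ?thesis using \<open>Re (cnj a * Q) = 0\<close> by (intro exI[of _ a]) simp
  next
    assume "AE x in ?L. Re (b + \<phi> x) > 0"
    then show ?thesis using \<open>Re Q \<le> 0\<close> by (intro exI[of _ 1]) simp
  next
    assume "AE x in ?L. Im (b + \<phi> x) > 0"
    then show ?thesis using \<open>Im Q = 0\<close> by (intro exI[of _ \<i>]) (simp add: add.commute)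
  next
    assume "AE x in ?L. Im (b + \<phi> x) < 0"
    then show ?thesis using \<open>Im Q = 0\<close> by (intro exI[of _ "- \<i>"]) (auto elim: eventually_mono)
  qed
  then show ?thesis
    using AE_eq_0_of_coercive[OF q] unfolding Q_def by blast
qed

text \<open>
  Once \<open>u\<^sub>1 = u\<^sub>2\<close>, all terms of the two equations agree except those with \<open>U\<^sub>1\<close> and \<open>U\<^sub>2\<close>; as \<open>a \<noteq> 0\<close>,
  the difference of the sections is orthogonal to every test function.
\<close>

lemma weak_solutions_unique:
  assumes "open \<Omega>" "admissible_space \<Omega> X" "a \<noteq> 0" "Re a \<ge> 0"
    and "AE x in lebesgue_on \<Omega>. Re (cnj a * (b + \<phi> x)) \<ge> 0"
    and "(AE x in lebesgue_on \<Omega>. Re (cnj a * (b + \<phi> x)) > 0) \<or>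
       (AE x in lebesgue_on \<Omega>. Re (b + \<phi> x) > 0) \<or>
       (AE x in lebesgue_on \<Omega>. Im (b + \<phi> x) > 0) \<or>
       (AE x in lebesgue_on \<Omega>. Im (b + \<phi> x) < 0)"
    and s1: "weak_solution_in X \<Omega> a b \<phi> F u1 U1" and s2: "weak_solution_in X \<Omega> a b \<phi> F u2 U2"
  shows "(AE x in lebesgue_on \<Omega>. u1 x = u2 x) \<and> (AE x in lebesgue_on \<Omega>. U1 x = U2 x)"
proof -
  let ?L = "lebesgue_on \<Omega>"
  have u: "AE x in ?L. u1 x = u2 x"
    using weak_solutions_difference_eq_0[OF assms] by simp
  have loc: "u1 \<in> L1_loc \<Omega>" "u2 \<in> L1_loc \<Omega>" and U: "U1 \<in> Linf \<Omega>" "U2 \<in> Linf \<Omega>"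
    and pu: "(\<lambda>x. \<phi> x * u1 x) \<in> borel_measurable ?L" "(\<lambda>x. \<phi> x * u2 x) \<in> borel_measurable ?L"
    using s1 s2 by (auto simp: weak_solution_in_def saturated_section_def Lp_def)
  have wp: "weak_partial \<Omega> i u1 = weak_partial \<Omega> i u2" if "i \<in> Basis" for i
    using assms(1) that loc u by (rule weak_partial_cong_AE)
  have "AE x in ?L. 1 * U1 x + (- 1) * U2 x = 0"
  proof (rule AE_eq_0_of_test_functions[OF assms(1)])
    show "(\<lambda>x. 1 * U1 x + (- 1) * U2 x) \<in> L1_loc \<Omega>"
      using U by (intro L1_loc_lincomb Linf_imp_L1_loc[OF assms(1)])
    fix \<psi> assume \<psi>: "\<psi> \<in> test_functions \<Omega>" and real: "\<And>x. cnj (\<psi> x) = \<psi> x"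
    then have X: "\<psi> \<in> X" using assms(2) by (auto simp: admissible_space_def)
    have cong: "pairing \<Omega> f \<psi> = pairing \<Omega> g \<psi>"
      if "f \<in> borel_measurable ?L" "g \<in> borel_measurable ?L" "AE x in ?L. f x = g x" for f g
      unfolding pairing_def
    proof (rule integral_cong_AE)
      show "AE x in ?L. f x * cnj (\<psi> x) = g x * cnj (\<psi> x)"
        using that(3) by eventually_elim simp
    qed (use that test_function_measurable[OF assms(1) \<psi>] in
        \<open>auto intro!: borel_measurable_times borel_measurable_cnj\<close>)
    have "pairing \<Omega> u1 \<psi> = pairing \<Omega> u2 \<psi>"
      using loc u by (intro cong) (auto simp: L1_loc_def)
    moreover have "pairing \<Omega> (\<lambda>x. \<phi> x * u1 x) \<psi> = pairing \<Omega> (\<lambda>x. \<phi> x * u2 x) \<psi>"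
      using pu u by (intro cong) (auto elim: eventually_mono)
    moreover have "sesquilinear_form \<Omega> a b \<phi> u1 U1 \<psi> = sesquilinear_form \<Omega> a b \<phi> u2 U2 \<psi>"
      by (rule weak_solutions_same_form[OF assms(1,2) s1 s2 X])
    ultimately have "a * pairing \<Omega> U1 \<psi> = a * pairing \<Omega> U2 \<psi>"
      by (simp add: sesquilinear_form_def wp)
    then have "(LINT x|?L. U1 x * \<psi> x) = (LINT x|?L. U2 x * \<psi> x)"
      using \<open>a \<noteq> 0\<close> by (simp add: pairing_def real)
    then show "(LINT x|?L. (1 * U1 x + (- 1) * U2 x) * \<psi> x) = 0"
      using L1_loc_mult_test_function_integrable[OF assms(1) Linf_imp_L1_loc[OF assms(1)] \<psi>] U
      by (simp add: left_diff_distrib)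
  qed
  then have "AE x in ?L. U1 x = U2 x" by eventually_elim simp
  with u show ?thesis ..
qed

lemma admissible_space_Dirichlet: "open \<Omega> \<Longrightarrow> admissible_space \<Omega> (H10 \<Omega> \<inter> Lp \<Omega> 1)"
  unfolding admissible_space_def
  by (auto simp: H10_scale Lp_scale test_function_H10 test_function_Lp) (simp add: H10_def)

text \<open>
  Finite measure serves to embed \<open>L\<^sup>2(\<Omega>)\<close> in \<open>L\<^sup>1(\<Omega>)\<close>.
\<close>

lemma admissible_space_Neumann:
  "open \<Omega> \<Longrightarrow> emeasure lebesgue \<Omega> < \<infinity> \<Longrightarrow> admissible_space \<Omega> (H1 \<Omega>)"
  unfolding admissible_space_def
  by (auto simp: H1_scale test_function_H1 intro: Lp_2_imp_Lp_1) (auto simp: H1_def intro: Lp_2_imp_Lp_1)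

lemma borel_measurable_lebesgue_on_cong_AE:
  fixes f g :: "'a::euclidean_space \<Rightarrow> complex"
  assumes "S \<in> sets lebesgue" "f \<in> borel_measurable (lebesgue_on S)" "AE x in lebesgue_on S. f x = g x"
  shows "g \<in> borel_measurable (lebesgue_on S)"
proof -
  have "(\<lambda>x. if x \<in> S then f x else 0) \<in> borel_measurable lebesgue"
    using assms(1,2) by (simp add: borel_measurable_if)
  moreover have "AE x in lebesgue. (if x \<in> S then f x else 0) = (if x \<in> S then g x else 0)"
    using assms(1,3) by (simp add: AE_restrict_space_iff)
  ultimately have "(\<lambda>x. if x \<in> S then g x else 0) \<in> borel_measurable lebesgue"
    by (rule borel_measurable_AE)
  then show ?thesis using assms(1) by (simp add: borel_measurable_if)
qed

text \<open>
  Measurability of \<open>w\<close> matters: \<open>emeasure\<close> is 0 on nonmeasurable sets, so without it the last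
  hypothesis would say nothing about the zero set.
\<close>

lemma AE_nonzero_of_null_zero_set:
  fixes w :: "'a::euclidean_space \<Rightarrow> real"
  assumes "S \<in> sets lebesgue" "w \<in> borel_measurable (lebesgue_on S)"
    and "\<not> emeasure lebesgue {x \<in> S. w x = 0} > 0"
  shows "AE x in lebesgue_on S. w x \<noteq> 0"
proof -
  have "{x \<in> S. w x = 0} = w -` {0} \<inter> space (lebesgue_on S)" by auto
  also have "\<dots> \<in> sets (lebesgue_on S)" using assms(2) by (rule measurable_sets) simp
  finally have "{x \<in> S. w x = 0} \<in> sets lebesgue"
    using assms(1) by (simp add: sets_restrict_space_iff)
  then have "{x \<in> S. w x = 0} \<in> null_sets lebesgue"
    using assms(3) by (simp add: null_sets_def)
  then have "AE x in lebesgue. x \<in> S \<longrightarrow> w x \<noteq> 0"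
    by (rule AE_I') auto
  then show ?thesis using assms(1) by (simp add: AE_restrict_space_iff)
qed

theorem theorem2p8:
  fixes \<Omega> :: "'a::euclidean_space set"
    and \<phi> :: "'a \<Rightarrow> complex"
    and a b :: complex
    and p :: real
  assumes "open \<Omega>"
    and "potential_exponent DIM('a) p"
    and "\<phi> \<in> Linf_plus_Lp \<Omega> p"
    and "a \<noteq> 0"
    and "Re a \<ge> 0"
    and "AE x in lebesgue_on \<Omega>. Re (a * cnj b) + Re (a * cnj (\<phi> x)) \<ge> 0"
    and "emeasure lebesgue {x \<in> \<Omega>. Re (a * cnj b) + Re (a * cnj (\<phi> x)) = 0} > 0 \<Longrightarrow>
           (AE x in lebesgue_on \<Omega>. Re b + Re (\<phi> x) > 0) \<or>
           (AE x in lebesgue_on \<Omega>. Im b + Im (\<phi> x) > 0) \<or>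
           (AE x in lebesgue_on \<Omega>. Im b + Im (\<phi> x) < 0)"
  shows "(\<forall>F u\<^sub>1 U\<^sub>1 u\<^sub>2 U\<^sub>2.
            F \<in> H_minus1_plus_Linf \<Omega> \<longrightarrow>
            dirichlet_weak_solution \<Omega> a b \<phi> F u\<^sub>1 U\<^sub>1 \<longrightarrow>
            dirichlet_weak_solution \<Omega> a b \<phi> F u\<^sub>2 U\<^sub>2 \<longrightarrow>
            (AE x in lebesgue_on \<Omega>. u\<^sub>1 x = u\<^sub>2 x) \<and> (AE x in lebesgue_on \<Omega>. U\<^sub>1 x = U\<^sub>2 x)) \<and>
         (emeasure lebesgue \<Omega> < \<infinity> \<longrightarrow> uniformly_Lipschitz_boundary \<Omega> \<longrightarrow>
          (\<forall>F u\<^sub>1 U\<^sub>1 u\<^sub>2 U\<^sub>2.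
            F \<in> real_dual (H1 \<Omega>) (H1_norm \<Omega>) \<longrightarrow>
            neumann_weak_solution \<Omega> a b \<phi> F u\<^sub>1 U\<^sub>1 \<longrightarrow>
            neumann_weak_solution \<Omega> a b \<phi> F u\<^sub>2 U\<^sub>2 \<longrightarrow>
            (AE x in lebesgue_on \<Omega>. u\<^sub>1 x = u\<^sub>2 x) \<and> (AE x in lebesgue_on \<Omega>. U\<^sub>1 x = U\<^sub>2 x)))"
proof -
  let ?L = "lebesgue_on \<Omega>"
  have \<Omega>: "\<Omega> \<in> sets lebesgue" using assms(1) by simp
  have Re_eq: "Re (cnj a * (b + \<phi> x)) = Re (a * cnj b) + Re (a * cnj (\<phi> x))" for x
    by (simp add: algebra_simps)
  \<comment> \<open>A function in \<open>L\<^sup>\<infinity> + L\<^sup>p\<close> only agrees almost everywhere with a measurable sum; completeness of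
    the Lebesgue measure makes it measurable itself.\<close>
  have \<phi>: "\<phi> \<in> borel_measurable ?L"
  proof -
    obtain g h where gh: "g \<in> borel_measurable ?L" "h \<in> borel_measurable ?L"
      "AE x in ?L. \<phi> x = g x + h x"
      using assms(3) by (auto simp: Linf_plus_Lp_def Linf_def Lp_def)
    have "AE x in ?L. g x + h x = \<phi> x" using gh(3) by eventually_elim simp
    with borel_measurable_add[OF gh(1,2)] show ?thesis
      by (rule borel_measurable_lebesgue_on_cong_AE[OF \<Omega>])
  qed
  have meas: "(\<lambda>x. Re (a * cnj b) + Re (a * cnj (\<phi> x))) \<in> borel_measurable ?L"
    by (intro borel_measurable_add borel_measurable_const borel_measurable_Re[THEN measurable_compose[rotated]]
        borel_measurable_times borel_measurable_cnj \<phi>)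
  have nonneg: "AE x in ?L. Re (cnj a * (b + \<phi> x)) \<ge> 0"
    using assms(6) unfolding Re_eq .
  have alt: "(AE x in ?L. Re (cnj a * (b + \<phi> x)) > 0) \<or> (AE x in ?L. Re (b + \<phi> x) > 0) \<or>
       (AE x in ?L. Im (b + \<phi> x) > 0) \<or> (AE x in ?L. Im (b + \<phi> x) < 0)"
  proof (cases "emeasure lebesgue {x \<in> \<Omega>. Re (a * cnj b) + Re (a * cnj (\<phi> x)) = 0} > 0")
    case True
    from assms(7)[OF True] show ?thesis by simp
  next
    case False
    \<comment> \<open>The zero set is null, so the nonnegative weight is positive almost everywhere.\<close>
    have "AE x in ?L. Re (cnj a * (b + \<phi> x)) > 0"
      using AE_nonzero_of_null_zero_set[OF \<Omega> meas False] assms(6)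
      unfolding Re_eq by eventually_elim linarith
    then show ?thesis ..
  qed
  note unique = weak_solutions_unique[OF assms(1) _ assms(4,5) nonneg alt]
  show ?thesis
    unfolding dirichlet_weak_solution_def neumann_weak_solution_def
    using unique admissible_space_Dirichlet[OF assms(1)] admissible_space_Neumann[OF assms(1)] by blast
qed


end
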